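(* Let $Q(k) = (2k-1)(11k-3) = 22k^2-17k+3$. We have $$\sum_{k=1}^\infty \frac{16^k \binom{4k}{2k} \big( Q(k) H_{k-1} + (6k-1)(4k-3)/(2k-1) \big) }{k (4k-1)(4k-3)\binom{3k}{k} \binom{6k}{3k}} = 16G - 4 \pi \log 2,$$ $$\sum_{k=1}^\infty \frac{16^k \binom{4k}{2k} \big( Q(k) H_{2k-1} + (6k-1)(k-3)/(6k-3) \big) }{k (4k-1)(4k-3)\binom{3k}{k} \binom{6k}{3k}} = \frac{4}{3} (8G - \pi \log 2),$$ and $$\sum_{k=1}^\infty \frac{16^k \binom{4k}{2k} \big( Q(k) (2H_{6k-1}-H_{3k-1})+ 4(18k^2-20k+3)/(6k-3) \big) }{k (4k-1)(4k-3)\binom{3k}{k} \binom{6k}{3k}} = \frac{4}{3} (16G + \pi \log 2).$$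
   Context: For $n\in\{0,1,2,\ldots\}$, $H_n=\sum_{0<j\le n}\frac1j$ denotes the usual harmonic number (so $H_0=0$). $G=\sum_{k=0}^\infty \frac{(-1)^k}{(2k+1)^2}$ is the Catalan constant, and $\log$ is the natural logarithm. *)

theory Defs
  imports "HOL-Analysis.Analysis"
begin

definition catalan_const :: real where
  "catalan_const = (\<Sum>k. (-1) ^ k / (2 * real k + 1) ^ 2)"

definition Q :: "real \<Rightarrow> real" where
  "Q x = (2 * x - 1) * (11 * x - 3)"

lemma Q_expanded: "Q x = 22 * x ^ 2 - 17 * x + 3"
  by (simp add: Q_def algebra_simps power2_eq_square)

end

theory Submission
  imports Defs "HOL-Real_Asymp.Real_Asymp"
begin

text \<open>Up to elementary factors the summands are a weight
\<open>t n = 4^n n! (1/2)_{2n} / (1/2)_{3n+3}\<close> (with \<open>n = k - 1\<close>) times a polynomial that multiplies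
harmonic numbers, plus a rational function. Harmonic numbers are logarithmic derivatives of
Pochhammer symbols, so each series should be the derivative, along a line in a parameter space, of a
summation formula for \<open>\<Sum>t n Q(n + 1)\<close> with free parameters.

Such a formula comes from the alternating very-well-poised series: there are terms
\<open>F(n,k)\<close> and \<open>G(n,k)\<close>, depending on real parameters \<open>a, b, c, d\<close>, with
\<open>F(n+1,k) - F(n,k) = G(n,k+1) - G(n,k)\<close> (lemma \<open>wz_pair\<close>). Summing over a quadrant
turns \<open>\<Sum>n. G(n,0)\<close> into \<open>\<Sum>k. F(0,k)\<close>. At the base point
\<open>(a,b,c,d) = (1, 1/2, 1, 1/2)\<close> one has \<open>F(0,k) = (-1)^k / (2k+1)\<close> and
\<open>G(n,0) = t n Q(n + 1) / 8\<close>.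

The relation of the pair is linear and holds near the base point, so it survives differentiation along
\<open>(a,b,c,d) = (1 + u e, 1/2, 1 + w e, 1/2 + z e)\<close>. This yields pairs \<open>F', G'\<close> for all
directions \<open>(u,w,z)\<close>, and for three of them \<open>8 G'(n,0)\<close> is a summand of the theorem.
Up to rational functions, the logarithmic derivative of \<open>F(n,0)\<close> behaves as follows:
\<open>(-1, 0, -1)\<close> leaves only \<open>H_n\<close>,
\<open>(-1, -1/3, -1)\<close> leaves only \<open>H_{2n}\<close>, and \<open>(-2, -2/3, -1)\<close> leaves only the
sum of the reciprocals of the first \<open>3n\<close> half-integers \<open>i + 1/2\<close>. Both boundary terms at
infinity vanish: the terms tend to zero as \<open>k\<close> grows, and for \<open>n \<ge> 2\<close> they decay
geometrically in \<open>n\<close>, dominated by a convergent series over \<open>k\<close>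
(lemma \<open>deriv_G_sums\<close>).

There remains \<open>\<Sum>k. F'(0,k)\<close>, a combination of Catalan's series and of
\<open>\<Sum>(-1)^k H_k / (2k+1)\<close> and \<open>\<Sum>(-1)^k O_k / (2k+1)\<close>, where \<open>O_k\<close> is the sum of
\<open>1 / (i + 1/2)\<close> over \<open>i < k\<close>. Both reduce to the integral of
\<open>ln (1 + x^2) / (1 + x^2)\<close> over the unit interval, which a double integral relates to
Catalan's constant (lemma \<open>has_integral_ln_one_plus_square\<close>).\<close>

section \<open>Shifted harmonic numbers\<close>

text \<open>These sums are the logarithmic derivatives of the Pochhammer symbols: ordinary harmonic numbers are the
case \<open>x = 1\<close>, and \<open>x = 1/2\<close> gives twice the sums of reciprocal odd numbers.\<close>

definition shifted_harm :: "real \<Rightarrow> nat \<Rightarrow> real" where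
  "shifted_harm x m = (\<Sum>i<m. 1 / (x + real i))"

lemma shifted_harm_0 [simp]: "shifted_harm x 0 = 0"
  by (simp add: shifted_harm_def)

lemma shifted_harm_Suc: "shifted_harm x (Suc m) = shifted_harm x m + 1 / (x + real m)"
  by (simp add: shifted_harm_def)

lemma harm_conv_shifted_harm: "harm n = shifted_harm 1 n"
  by (simp add: harm_altdef shifted_harm_def inverse_eq_divide add.commute)

lemma shifted_harm_nonneg: "x > 0 \<Longrightarrow> 0 \<le> shifted_harm x m"
  unfolding shifted_harm_def by (intro sum_nonneg) auto

text \<open>The true growth is logarithmic. A square root is enough for every limit below, and it follows from the
telescoping comparison \<open>1 / (i + 1/2) \<le> 4 (sqrt (i + 1) - sqrt i)\<close>.\<close>

lemma shifted_harm_le_sqrt: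
  assumes "1 / 2 \<le> x"
  shows "shifted_harm x m \<le> 4 * sqrt (real m)"
proof (induction m)
  case (Suc m)
  define s t where "s = sqrt (real m)" and "t = sqrt (real m + 1)"
  have st: "0 \<le> s" "1 \<le> t" "s \<le> t" "s\<^sup>2 = real m" "t\<^sup>2 = real m + 1"
    unfolding s_def t_def by simp_all
  have "1 / (x + real m) \<le> 1 / (1 / 2 + real m)"
    using assms by (intro divide_left_mono) auto
  also have "\<dots> \<le> 2 / t\<^sup>2"
    using st by (simp add: field_simps)
  also have "\<dots> \<le> 4 / (t + s)"
  proof -
    have "t + s \<le> 2 * t\<^sup>2"
      using st mult_right_mono[of 1 t t] by (simp add: power2_eq_square)
    then show ?thesis
      using st by (simp add: field_simps)
  qed
  also have "\<dots> = 4 * (t - s)"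
  proof -
    have "(t - s) * (t + s) = 1"
      using st by (simp add: algebra_simps power2_eq_square)
    then show ?thesis
      using st by (simp add: field_simps)
  qed
  finally show ?case
    using Suc by (simp add: shifted_harm_Suc s_def t_def algebra_simps)
qed simp

lemma shifted_harm_sublinear:
  assumes "1 / 2 \<le> x"
  shows "(\<lambda>n. shifted_harm x n / real (2 * n + 3)) \<longlonglongrightarrow> 0"
proof (rule tendsto_sandwich[where f = "\<lambda>_. 0"])
  show "(\<lambda>n. 4 * sqrt (real n) / real (2 * n + 3)) \<longlonglongrightarrow> 0"
    by real_asymp
qed (use assms shifted_harm_le_sqrt shifted_harm_nonneg in \<open>auto intro!: always_eventually divide_right_mono divide_nonneg_nonneg\<close>)

lemma shifted_harm_three_halves:
  "shifted_harm (3 / 2) k = shifted_harm (1 / 2) k - 2 + 2 / (2 * real k + 1)"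
proof (induction k)
  case (Suc k)
  have "2 / (2 * real k + 1) = 1 / (1 / 2 + real k)"
    "2 / (2 * real (Suc k) + 1) = 1 / (3 / 2 + real k)"
    by (simp_all add: field_simps)
  then show ?case
    using Suc by (simp add: shifted_harm_Suc)
qed simp

lemma shifted_harm_double:
  "shifted_harm 1 (2 * n) = (shifted_harm 1 n + shifted_harm (1 / 2) n) / 2"
proof (induction n)
  case (Suc n)
  have "1 / (1 + real (2 * n)) = 1 / (1 / 2 + real n) / 2" "1 / (1 + real (Suc (2 * n))) = 1 / (1 + real n) / 2"
    by (simp_all add: field_simps)
  moreover have "shifted_harm 1 (2 * Suc n) =
      shifted_harm 1 (2 * n) + 1 / (1 + real (2 * n)) + 1 / (1 + real (Suc (2 * n)))"
    by (simp add: shifted_harm_Suc)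
  ultimately show ?case
    unfolding Suc.IH shifted_harm_Suc by (simp only: add_divide_distrib ac_simps)
qed simp

lemma two_harm_minus_harm:
  assumes "j > 0"
  shows "2 * harm (2 * j - 1) - harm (j - 1) = shifted_harm (1 / 2) j"
proof -
  obtain i where i: "j = Suc i" using assms by (cases j) auto
  have "shifted_harm 1 (2 * j) = harm (2 * j - 1) + 1 / (2 * real j)"
    unfolding harm_conv_shifted_harm i by (simp add: shifted_harm_Suc)
  moreover have "shifted_harm 1 j = harm (j - 1) + 1 / real j"
    unfolding harm_conv_shifted_harm i by (simp add: shifted_harm_Suc)
  ultimately show ?thesis
    using shifted_harm_double[of j] by (simp add: field_simps)
qed

section \<open>Two alternating series\<close>

lemma DERIV_monomial_antiderivative:
  "((\<lambda>t. c * t ^ Suc m / real (Suc m)) has_real_derivative c * x ^ m) (at x within S)"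
  using DERIV_cdivide[OF DERIV_cmult[OF DERIV_pow[of "Suc m" x S], of c], of "real (Suc m)"]
  by (simp del: of_nat_Suc)

text \<open>Compare \<open>f\<close> with the antiderivative of \<open>t ^ m\<close>: their sum and their difference are
nondecreasing. This replaces the usual estimate for the tail of an alternating power series, and unlike
the power series it includes the endpoint \<open>x = 1\<close>.\<close>

lemma abs_le_of_abs_deriv_le:
  fixes f f' :: "real \<Rightarrow> real"
  assumes f0: "f 0 = 0" and x: "0 \<le> x"
    and f': "\<And>t. 0 \<le> t \<Longrightarrow> (f has_real_derivative f' t) (at t)"
    and bound: "\<And>t. 0 \<le> t \<Longrightarrow> \<bar>f' t\<bar> \<le> t ^ m"
  shows "\<bar>f x\<bar> \<le> x ^ Suc m / real (Suc m)"
proof -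
  have D: "((\<lambda>t. t ^ Suc m / real (Suc m)) has_real_derivative t ^ m) (at t)" for t :: real
    using DERIV_monomial_antiderivative[of 1 m] by simp
  have "0 ^ Suc m / real (Suc m) - f 0 \<le> x ^ Suc m / real (Suc m) - f x"
  proof (rule DERIV_nonneg_imp_nondecreasing[OF x])
    fix t assume t: "0 \<le> t" "t \<le> x"
    show "\<exists>y. ((\<lambda>t. t ^ Suc m / real (Suc m) - f t) has_real_derivative y) (at t) \<and> 0 \<le> y"
      using DERIV_diff[OF D f'[OF t(1)]] bound[OF t(1)] by (intro exI[of _ "t ^ m - f' t"]) auto
  qed
  moreover have "0 ^ Suc m / real (Suc m) + f 0 \<le> x ^ Suc m / real (Suc m) + f x"
  proof (rule DERIV_nonneg_imp_nondecreasing[OF x])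
    fix t assume t: "0 \<le> t" "t \<le> x"
    show "\<exists>y. ((\<lambda>t. t ^ Suc m / real (Suc m) + f t) has_real_derivative y) (at t) \<and> 0 \<le> y"
      using DERIV_add[OF D f'[OF t(1)]] bound[OF t(1)] by (intro exI[of _ "t ^ m + f' t"]) auto
  qed
  ultimately show ?thesis
    using f0 by simp
qed

lemma alternating_geometric_remainder:
  fixes t :: real
  shows "1 / (1 + t\<^sup>2) - (\<Sum>k<N. (-1) ^ k * t ^ (2 * k)) = (-1) ^ N * t ^ (2 * N) / (1 + t\<^sup>2)"
proof -
  have pos: "1 + t\<^sup>2 \<noteq> 0"
    by (metis add_pos_nonneg less_irrefl zero_le_power2 zero_less_one)
  have "(\<Sum>k<N. (-1) ^ k * t ^ (2 * k)) * (1 + t\<^sup>2) = 1 - (-1) ^ N * t ^ (2 * N)"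
    by (induction N) (simp_all add: algebra_simps power2_eq_square)
  then show ?thesis
    using pos by (simp add: field_simps)
qed

lemma abs_alternating_geometric_remainder_le:
  fixes t :: real
  assumes "0 \<le> t"
  shows "\<bar>1 / (1 + t\<^sup>2) - (\<Sum>k<N. (-1) ^ k * t ^ (2 * k))\<bar> \<le> t ^ (2 * N)"
proof -
  have "t ^ (2 * N) / (1 + t\<^sup>2) \<le> t ^ (2 * N) / 1"
    using assms by (intro divide_left_mono) (auto intro: add_pos_nonneg)
  moreover have "1 + t\<^sup>2 > 0" by (auto intro: add_pos_nonneg)
  ultimately show ?thesis
    using assms by (simp add: alternating_geometric_remainder abs_mult power_abs)
qed

lemma arctan_partial_sum_error:
  assumes "0 \<le> x"
  shows "\<bar>arctan x - (\<Sum>k<N. (-1) ^ k * x ^ (2 * k + 1) / real (2 * k + 1))\<bar>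
           \<le> x ^ (2 * N + 1) / real (2 * N + 1)"
proof -
  have "\<bar>arctan x - (\<Sum>k<N. (-1) ^ k * x ^ (2 * k + 1) / real (2 * k + 1))\<bar>
           \<le> x ^ Suc (2 * N) / real (Suc (2 * N))"
  proof (rule abs_le_of_abs_deriv_le[OF _ assms])
    fix t :: real assume t: "0 \<le> t"
    have S: "((\<lambda>x. \<Sum>k<N. (-1) ^ k * x ^ (2 * k + 1) / real (2 * k + 1))
            has_real_derivative (\<Sum>k<N. (-1) ^ k * t ^ (2 * k))) (at t)"
    proof (rule DERIV_sum)
      fix k
      show "((\<lambda>x. (-1) ^ k * x ^ (2 * k + 1) / real (2 * k + 1)) has_real_derivative
              (-1) ^ k * t ^ (2 * k)) (at t)"
        using DERIV_monomial_antiderivative[of "(-1) ^ k" "2 * k"] by simp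
    qed
    show "((\<lambda>x. arctan x - (\<Sum>k<N. (-1) ^ k * x ^ (2 * k + 1) / real (2 * k + 1)))
            has_real_derivative (1 / (1 + t\<^sup>2) - (\<Sum>k<N. (-1) ^ k * t ^ (2 * k)))) (at t)"
      using DERIV_diff[OF DERIV_arctan S] by (simp add: inverse_eq_divide)
    show "\<bar>1 / (1 + t\<^sup>2) - (\<Sum>k<N. (-1) ^ k * t ^ (2 * k))\<bar> \<le> t ^ (2 * N)"
      by (rule abs_alternating_geometric_remainder_le[OF t])
  qed simp
  then show ?thesis by simp
qed

lemma ln_one_plus_square_partial_sum_error:
  assumes "0 \<le> x"
  shows "\<bar>ln (1 + x\<^sup>2) - (\<Sum>k<N. (-1) ^ k * x ^ (2 * k + 2) / real (k + 1))\<bar>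
           \<le> x ^ (2 * N + 2) / real (N + 1)"
proof -
  have error: "\<bar>ln (1 + x\<^sup>2) / 2 - (\<Sum>k<N. (-1) ^ k * x ^ (2 * k + 2) / real (2 * (k + 1)))\<bar>
           \<le> x ^ Suc (2 * N + 1) / real (Suc (2 * N + 1))"
  proof (rule abs_le_of_abs_deriv_le[OF _ assms])
    fix t :: real assume t: "0 \<le> t"
    have pos: "1 + t\<^sup>2 > 0" by (auto intro: add_pos_nonneg)
    have S: "((\<lambda>x. \<Sum>k<N. (-1) ^ k * x ^ (2 * k + 2) / real (2 * (k + 1)))
            has_real_derivative (\<Sum>k<N. (-1) ^ k * t ^ (2 * k + 1))) (at t)"
    proof (rule DERIV_sum)
      fix k
      show "((\<lambda>x. (-1) ^ k * x ^ (2 * k + 2) / real (2 * (k + 1))) has_real_derivative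
              (-1) ^ k * t ^ (2 * k + 1)) (at t)"
        using DERIV_monomial_antiderivative[of "(-1) ^ k" "2 * k + 1"] by simp
    qed
    have L: "((\<lambda>x. ln (1 + x\<^sup>2) / 2) has_real_derivative t / (1 + t\<^sup>2)) (at t)"
      using pos by (auto intro!: derivative_eq_intros simp: field_simps)
    have eq: "t / (1 + t\<^sup>2) - (\<Sum>k<N. (-1) ^ k * t ^ (2 * k + 1))
          = t * (1 / (1 + t\<^sup>2) - (\<Sum>k<N. (-1) ^ k * t ^ (2 * k)))"
      by (simp add: right_diff_distrib sum_distrib_left mult_ac)
    show "((\<lambda>x. ln (1 + x\<^sup>2) / 2 - (\<Sum>k<N. (-1) ^ k * x ^ (2 * k + 2) / real (2 * (k + 1))))
            has_real_derivative (t * (1 / (1 + t\<^sup>2) - (\<Sum>k<N. (-1) ^ k * t ^ (2 * k))))) (at t)"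
      using DERIV_diff[OF L S] by (simp only: eq)
    show "\<bar>t * (1 / (1 + t\<^sup>2) - (\<Sum>k<N. (-1) ^ k * t ^ (2 * k)))\<bar> \<le> t ^ (2 * N + 1)"
      using abs_alternating_geometric_remainder_le[OF t, of N] t
      by (simp add: abs_mult mult_left_mono)
  qed simp
  have half: "u / 2 \<le> v / 2 \<Longrightarrow> u \<le> v" for u v :: real
    by simp
  note error
  also have "ln (1 + x\<^sup>2) / 2 - (\<Sum>k<N. (-1) ^ k * x ^ (2 * k + 2) / real (2 * (k + 1)))
      = (ln (1 + x\<^sup>2) - (\<Sum>k<N. (-1) ^ k * x ^ (2 * k + 2) / real (k + 1))) / 2"
    by (simp add: diff_divide_distrib sum_divide_distrib mult_ac)
  also have "x ^ Suc (2 * N + 1) / real (Suc (2 * N + 1)) = x ^ (2 * N + 2) / real (N + 1) / 2"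
    by (simp add: field_simps)
  finally show ?thesis
    unfolding abs_divide abs_numeral by (rule half)
qed

lemma has_integral_monomial_unit: "((\<lambda>x::real. x ^ m) has_integral 1 / real (Suc m)) {0..1}"
proof -
  have "((\<lambda>x::real. x ^ m) has_integral (1 ^ Suc m / real (Suc m) - 0 ^ Suc m / real (Suc m))) {0..1}"
  proof (rule fundamental_theorem_of_calculus)
    fix x :: real
    have "((\<lambda>t. t ^ Suc m / real (Suc m)) has_real_derivative x ^ m) (at x within {0..1})"
      using DERIV_monomial_antiderivative[of 1 m] by simp
    then show "((\<lambda>t. t ^ Suc m / real (Suc m)) has_vector_derivative x ^ m) (at x within {0..1})"
      by (simp add: has_real_derivative_iff_has_vector_derivative)
  qed simp
  then show ?thesis by simp
qed

text \<open>Termwise integration, with an error bound that may depend on \<open>x\<close>: only the integral of the bound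
has to tend to zero. The dependence matters in \<open>alternating_sum_via_integral\<close>, where the bound
is unbounded near \<open>x = 1\<close> as \<open>N\<close> grows.\<close>

lemma has_integral_limit_of_majorized_error:
  fixes f :: "real \<Rightarrow> real"
  assumes f: "(f has_integral I) {0..1}"
    and p: "\<And>N. (p N has_integral s N) {0..1}"
    and g: "\<And>N. (g N has_integral E N) {0..1}"
    and le: "\<And>N x. 0 \<le> x \<Longrightarrow> x \<le> 1 \<Longrightarrow> \<bar>f x - p N x\<bar> \<le> g N x"
    and E: "E \<longlonglongrightarrow> 0"
  shows "s \<longlonglongrightarrow> I"
proof (rule LIM_zero_cancel, rule Lim_null_comparison[OF _ E], intro always_eventually allI)
  fix N
  have d: "((\<lambda>x. f x - p N x) has_integral (I - s N)) {0..1}"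
    by (rule has_integral_diff[OF f p])
  have "norm (integral {0..1} (\<lambda>x. f x - p N x)) \<le> integral {0..1} (g N)"
    using d g[of N] le by (intro integral_norm_bound_integral) (auto simp: integrable_on_def)
  then show "norm (s N - I) \<le> E N"
    using d g[of N] by (simp add: integral_unique norm_minus_commute abs_minus_commute)
qed

lemma summable_catalan: "summable (\<lambda>k. (-1) ^ k / (2 * real k + 1) ^ 2 :: real)"
proof -
  have "(\<lambda>n. 1 / (2 * real n + 1) ^ 2) \<longlonglongrightarrow> 0" by real_asymp
  then have "summable (\<lambda>n. (-1) ^ n * (1 / (2 * real n + 1) ^ 2))"
    by (rule summable_Leibniz') (auto intro!: divide_left_mono power_mono)
  then show ?thesis by simp
qed

text \<open>Termwise integration of the arctangent series divided by \<open>x\<close>. The value at \<open>0\<close> is left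
open so that the lemma applies to the inner integral of a double integral.\<close>

lemma has_integral_arctan_div_catalan:
  assumes f: "(f has_integral I) {0..1}"
    and eq: "\<And>x. 0 < x \<Longrightarrow> x \<le> 1 \<Longrightarrow> f x = arctan x / x"
  shows "I = catalan_const"
proof -
  \<comment> \<open>In HOL the quotient at 0 is 0, but the partial sums of the series equal 1 there.\<close>
  define f1 where "f1 x = (if x = 0 then 1 else f x)" for x :: real
  have f1: "(f1 has_integral I) {0..1}"
    using has_integral_spike_finite[OF _ _ f, of "{0}" f1] by (auto simp: f1_def)
  have "(\<lambda>N. \<Sum>k<N. (-1) ^ k / (2 * real k + 1) ^ 2) \<longlonglongrightarrow> I"
  proof (rule has_integral_limit_of_majorized_error[OF f1])
    show "(\<lambda>N. 1 / real (2 * N + 1)) \<longlonglongrightarrow> 0" by real_asymp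
    fix N
    show "((\<lambda>x. \<Sum>k<N. (-1) ^ k / (2 * real k + 1) * x ^ (2 * k)) has_integral
            (\<Sum>k<N. (-1) ^ k / (2 * real k + 1) ^ 2)) {0..1}"
    proof (rule has_integral_sum)
      fix k
      show "((\<lambda>x. (-1) ^ k / (2 * real k + 1) * x ^ (2 * k)) has_integral
            (-1) ^ k / (2 * real k + 1) ^ 2) {0..1}"
        using has_integral_mult_right[OF has_integral_monomial_unit[of "2 * k"],
            of "(-1) ^ k / (2 * real k + 1)"]
        by (simp add: power2_eq_square add.commute)
    qed simp
    show "((\<lambda>_. 1 / real (2 * N + 1)) has_integral 1 / real (2 * N + 1)) {0..1::real}"
      using has_integral_const_real[of "1 / real (2 * N + 1)" 0 1] by simp
    fix x :: real assume x: "0 \<le> x" "x \<le> 1"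
    show "\<bar>f1 x - (\<Sum>k<N. (-1) ^ k / (2 * real k + 1) * x ^ (2 * k))\<bar> \<le> 1 / real (2 * N + 1)"
    proof (cases "x = 0")
      case True
      show ?thesis
      proof (cases N)
        case (Suc M)
        have "(\<Sum>k<N. (-1) ^ k / (2 * real k + 1) * x ^ (2 * k)) = 1"
          unfolding Suc sum.lessThan_Suc_shift using True by simp
        then show ?thesis using True by (simp add: f1_def)
      qed (use True in \<open>simp add: f1_def\<close>)
    next
      case False
      with x have x0: "x > 0" by simp
      have eq1: "x * (f1 x - (\<Sum>k<N. (-1) ^ k / (2 * real k + 1) * x ^ (2 * k)))
          = arctan x - (\<Sum>k<N. (-1) ^ k * x ^ (2 * k + 1) / real (2 * k + 1))"
        using x0 x eq[of x] by (simp add: f1_def right_diff_distrib sum_distrib_left mult_ac add.commute)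
      have "x * \<bar>f1 x - (\<Sum>k<N. (-1) ^ k / (2 * real k + 1) * x ^ (2 * k))\<bar>
          = \<bar>arctan x - (\<Sum>k<N. (-1) ^ k * x ^ (2 * k + 1) / real (2 * k + 1))\<bar>"
        using arg_cong[OF eq1, of abs] x0 by (simp only: abs_mult abs_of_pos)
      also have "\<dots> \<le> x * (x ^ (2 * N) / real (2 * N + 1))"
        using arctan_partial_sum_error[OF x(1), of N] by simp
      finally have "\<bar>f1 x - (\<Sum>k<N. (-1) ^ k / (2 * real k + 1) * x ^ (2 * k))\<bar>
          \<le> x ^ (2 * N) / real (2 * N + 1)"
        using x0 by (rule mult_left_le_imp_le)
      also have "\<dots> \<le> 1 / real (2 * N + 1)"
        using x by (intro divide_right_mono power_le_one) auto
      finally show ?thesis .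
    qed
  qed
  then show ?thesis
    using summable_LIMSEQ[OF summable_catalan] unfolding catalan_const_def
    by (rule LIMSEQ_unique)
qed

text \<open>Integrate the kernel \<open>\<phi> r x\<close> over the unit square in both orders. It is the \<open>r\<close>-derivative
of \<open>ln ((1+r)^2 + (1-r)^2 x^2) / (1 + x^2)\<close>. For \<open>x = tan \<theta>\<close> this logarithm is
\<open>ln (1 + 2 r cos (2 \<theta>) + r^2)\<close> plus a term free of \<open>r\<close>, and \<open>1 / (1 + x^2)\<close> is the
Jacobian. Integration over \<open>r\<close> gives \<open>(ln 4 - ln (1 + x^2)) / (1 + x^2)\<close>.
Integration over \<open>x\<close> gives \<open>arctan r / r\<close>, whose integral is Catalan's constant.\<close>

lemma has_integral_ln_one_plus_square:
  "((\<lambda>x. ln (1 + x\<^sup>2) / (1 + x\<^sup>2)) has_integral (pi / 2 * ln 2 - catalan_const)) {0..1::real}"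
proof -
  define \<phi> :: "real \<Rightarrow> real \<Rightarrow> real" where
    "\<phi> r x = (2 * (1 + r) - 2 * (1 - r) * x\<^sup>2) / (((1 + r)\<^sup>2 + (1 - r)\<^sup>2 * x\<^sup>2) * (1 + x\<^sup>2))" for r x
  have pos1: "1 + x\<^sup>2 > 0" for x :: real
    by (auto intro: add_pos_nonneg)
  have pos2: "(1 + r)\<^sup>2 + (1 - r)\<^sup>2 * x\<^sup>2 > 0" if "0 \<le> r" for r x :: real
    using that by (intro add_pos_nonneg) auto
  have cont: "continuous_on (cbox (0, 0) (1, 1)) (\<lambda>(r, x). \<phi> r x)"
    unfolding \<phi>_def case_prod_beta
    using pos1 pos2 by (intro continuous_intros) (auto simp: less_imp_neq[symmetric])
  have int_r: "((\<lambda>r. \<phi> r x) has_integral ((2 * ln 2 - ln (1 + x\<^sup>2)) / (1 + x\<^sup>2))) {0..1}" for x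
  proof -
    let ?F = "\<lambda>r. ln ((1 + r)\<^sup>2 + (1 - r)\<^sup>2 * x\<^sup>2) / (1 + x\<^sup>2)"
    have "((\<lambda>r. \<phi> r x) has_integral (?F 1 - ?F 0)) {0..1}"
    proof (rule fundamental_theorem_of_calculus)
      fix r :: real assume "r \<in> {0..1}"
      then have "(?F has_real_derivative \<phi> r x) (at r within {0..1})"
        using pos1[of x] pos2[of r x] unfolding \<phi>_def
        by (auto intro!: derivative_eq_intros simp: divide_simps) (simp add: algebra_simps)?
      then show "(?F has_vector_derivative \<phi> r x) (at r within {0..1})"
        by (simp add: has_real_derivative_iff_has_vector_derivative)
    qed simp
    moreover have "ln 4 = 2 * ln (2::real)"
      using ln_realpow[of 2 2] by simp
    ultimately show ?thesis by (simp add: diff_divide_distrib)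
  qed
  have int_x: "((\<lambda>x. \<phi> r x) has_integral (arctan r / r)) {0..1}" if r: "0 < r" "r \<le> 1" for r
  proof -
    define q where "q = (1 - r) / (1 + r)"
    have q: "0 \<le> q" "q < 1" using r by (auto simp: q_def)
    let ?F = "\<lambda>x. (arctan x - arctan (q * x)) / r"
    have I: "((\<lambda>x. \<phi> r x) has_integral (?F 1 - ?F 0)) {0..1}"
    proof (rule fundamental_theorem_of_calculus)
      fix x :: real assume "x \<in> {0..1}"
      have A: "(?F has_real_derivative ((1 / (1 + x\<^sup>2) - q / (1 + (q * x)\<^sup>2)) / r)) (at x within {0..1})"
        using r pos1[of x] pos1[of "q * x"]
        by (auto intro!: derivative_eq_intros simp: inverse_eq_divide)
      have "q / (1 + (q * x)\<^sup>2) = (1 - r) * (1 + r) / ((1 + r)\<^sup>2 + (1 - r)\<^sup>2 * x\<^sup>2)"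
        using r pos1[of "q * x"] pos2[of r x]
        by (simp add: q_def power_divide power_mult_distrib divide_simps) (simp add: power2_eq_square algebra_simps)?
      also have "(1 / (1 + x\<^sup>2) - \<dots>) / r = \<phi> r x"
        using r pos1[of x] pos2[of r x] unfolding \<phi>_def
        by (simp add: divide_simps) (simp add: power2_eq_square algebra_simps)?
      finally have "(1 / (1 + x\<^sup>2) - q / (1 + (q * x)\<^sup>2)) / r = \<phi> r x" .
      with A show "(?F has_vector_derivative \<phi> r x) (at x within {0..1})"
        by (simp add: has_real_derivative_iff_has_vector_derivative)
    qed simp
    have "arctan r + arctan q = arctan ((r + q) / (1 - r * q))"
      using r q by (intro arctan_add) auto
    moreover have "(r + q) / (1 - r * q) = 1"
    proof -
      have "r * q < 1" using mult_left_mono[of q 1 r] mult_strict_left_mono[of q 1 r] r q by linarith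
      moreover have "r + q = 1 - r * q"
        using r by (simp add: q_def field_simps)
      ultimately show ?thesis by simp
    qed
    ultimately have "arctan 1 - arctan q = arctan r"
      by simp
    with I show ?thesis by simp
  qed
  define \<psi> where "\<psi> r = integral {0..1} (\<lambda>x. \<phi> r x)" for r
  have "integral {0..1} \<psi> = catalan_const"
  proof (rule has_integral_arctan_div_catalan)
    have "\<psi> integrable_on cbox 0 1"
      using integral_integrable_2dim[OF cont] by (simp add: \<psi>_def[abs_def])
    then show "(\<psi> has_integral (integral {0..1} \<psi>)) {0..1}"
      by (simp add: has_integral_integral)
    show "\<psi> r = arctan r / r" if "0 < r" "r \<le> 1" for r
      using int_x[OF that] by (simp add: \<psi>_def integral_unique)
  qed
  moreover have "integral {0..1} \<psi> = integral {0..1} (\<lambda>x. integral {0..1} (\<lambda>r. \<phi> r x))"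
    using integral_swap_continuous[OF cont] by (simp add: \<psi>_def[abs_def])
  moreover have "(\<lambda>x. integral {0..1} (\<lambda>r. \<phi> r x)) = (\<lambda>x. (2 * ln 2 - ln (1 + x\<^sup>2)) / (1 + x\<^sup>2))"
    using int_r by (auto simp: integral_unique)
  ultimately have I: "integral {0..1} (\<lambda>x::real. (2 * ln 2 - ln (1 + x\<^sup>2)) / (1 + x\<^sup>2)) = catalan_const"
    by simp
  have intA: "((\<lambda>x. 1 / (1 + x\<^sup>2)) has_integral (arctan 1 - arctan 0)) {0..1::real}"
  proof (rule fundamental_theorem_of_calculus)
    fix x :: real
    show "(arctan has_vector_derivative (1 / (1 + x\<^sup>2))) (at x within {0..1})"
      by (auto intro!: derivative_eq_intros simp: inverse_eq_divide
          simp flip: has_real_derivative_iff_has_vector_derivative)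
  qed simp
  have "(\<lambda>x::real. (2 * ln 2 - ln (1 + x\<^sup>2)) / (1 + x\<^sup>2)) integrable_on {0..1}"
    using pos1 by (intro integrable_continuous_real continuous_intros) (auto simp: less_imp_neq[symmetric])
  with I have intB: "((\<lambda>x::real. (2 * ln 2 - ln (1 + x\<^sup>2)) / (1 + x\<^sup>2)) has_integral catalan_const) {0..1}"
    by (metis integrable_integral)
  have "((\<lambda>x::real. 2 * ln 2 * (1 / (1 + x\<^sup>2)) - (2 * ln 2 - ln (1 + x\<^sup>2)) / (1 + x\<^sup>2))
      has_integral (2 * ln 2 * (arctan 1 - arctan 0) - catalan_const)) {0..1}"
    by (intro has_integral_diff has_integral_mult_right intA intB)
  then show ?thesis
    by (simp add: arctan_one diff_divide_distrib)
qed

text \<open>Integration by parts against the previous integral: the sum of both integrands is the derivative of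
\<open>ln (1 + x^2) arctan x\<close>.\<close>

lemma has_integral_two_x_arctan:
  "((\<lambda>x. 2 * x * arctan x / (1 + x\<^sup>2)) has_integral (catalan_const - pi / 4 * ln 2)) {0..1::real}"
proof -
  have pos1: "1 + x\<^sup>2 > 0" for x :: real
    by (auto intro: add_pos_nonneg)
  let ?F = "\<lambda>x::real. ln (1 + x\<^sup>2) * arctan x"
  have "((\<lambda>x. 2 * x * arctan x / (1 + x\<^sup>2) + ln (1 + x\<^sup>2) / (1 + x\<^sup>2)) has_integral (?F 1 - ?F 0)) {0..1}"
  proof (rule fundamental_theorem_of_calculus)
    fix x :: real
    have "(?F has_real_derivative (2 * x * arctan x / (1 + x\<^sup>2) + ln (1 + x\<^sup>2) / (1 + x\<^sup>2)))
        (at x within {0..1})"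
      using pos1[of x] by (auto intro!: derivative_eq_intros simp: field_simps)
    then show "(?F has_vector_derivative (2 * x * arctan x / (1 + x\<^sup>2) + ln (1 + x\<^sup>2) / (1 + x\<^sup>2)))
        (at x within {0..1})"
      by (simp add: has_real_derivative_iff_has_vector_derivative)
  qed simp
  from has_integral_diff[OF this has_integral_ln_one_plus_square] show ?thesis
    by (simp add: arctan_one algebra_simps)
qed

text \<open>Multiplying \<open>\<Sum>(-1)^k h k x^(2k)\<close> by \<open>1 + x^2\<close> replaces the coefficients \<open>h k\<close> by
their differences, so the series is \<open>- D x / (1 + x^2)\<close>, where \<open>D x\<close> is the sum of
\<open>(-1)^k (h (k+1) - h k) x^(2k+2)\<close>. For partial sums there is an extra term
\<open>h N x^(2N+2)\<close>; it is large at \<open>x = 1\<close>, but its integral is \<open>h N / (2N+3)\<close>.\<close>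

lemma alternating_sum_via_integral:
  fixes h :: "nat \<Rightarrow> real"
  assumes h0: "h 0 = 0" and h_nonneg: "\<And>n. 0 \<le> h n"
    and h_lim: "(\<lambda>n. h n / real (2 * n + 3)) \<longlonglongrightarrow> 0"
    and D: "\<And>N x. 0 \<le> x \<Longrightarrow> x \<le> 1 \<Longrightarrow>
        \<bar>D x - (\<Sum>k<N. (-1) ^ k * (h (Suc k) - h k) * x ^ (2 * k + 2))\<bar> \<le> e N"
    and e: "e \<longlonglongrightarrow> 0"
    and I: "((\<lambda>x. D x / (1 + x\<^sup>2)) has_integral I) {0..1}"
  shows "(\<lambda>k. (-1) ^ k / (2 * real k + 1) * h k) sums (- I)"
proof -
  have pos1: "1 + x\<^sup>2 > 0" for x :: real
    by (auto intro: add_pos_nonneg)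
  have "(\<lambda>N. \<Sum>k<Suc N. (-1) ^ k / (2 * real k + 1) * h k) \<longlonglongrightarrow> - I"
  proof (rule has_integral_limit_of_majorized_error)
    show "((\<lambda>x. - (D x / (1 + x\<^sup>2))) has_integral - I) {0..1}"
      by (rule has_integral_neg[OF I])
    fix N
    show "((\<lambda>x. \<Sum>k<Suc N. (-1) ^ k * h k * x ^ (2 * k)) has_integral
        (\<Sum>k<Suc N. (-1) ^ k / (2 * real k + 1) * h k)) {0..1}"
    proof (rule has_integral_sum)
      fix k
      show "((\<lambda>x. (-1) ^ k * h k * x ^ (2 * k)) has_integral (-1) ^ k / (2 * real k + 1) * h k) {0..1}"
        using has_integral_mult_right[OF has_integral_monomial_unit[of "2 * k"], of "(-1) ^ k * h k"]
        by (simp add: add.commute)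
    qed simp
    show "((\<lambda>x. e N + h N * x ^ (2 * N + 2)) has_integral (e N + h N * (1 / real (Suc (2 * N + 2))))) {0..1::real}"
      using has_integral_add[OF has_integral_const_real[of "e N" 0 1]
          has_integral_mult_right[OF has_integral_monomial_unit[of "2 * N + 2"], of "h N"]]
      by simp
    fix x :: real assume x: "0 \<le> x" "x \<le> 1"
    have parts: "(1 + x\<^sup>2) * (\<Sum>k<Suc N. (-1) ^ k * h k * x ^ (2 * k))
        = (-1) ^ N * h N * x ^ (2 * N + 2) - (\<Sum>k<N. (-1) ^ k * (h (Suc k) - h k) * x ^ (2 * k + 2))"
    proof (induction N)
      case (Suc N)
      then show ?case
        unfolding sum.lessThan_Suc[of _ "Suc N"] distrib_left[of "1 + x\<^sup>2"]
        by (simp add: algebra_simps power2_eq_square)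
    qed (simp add: h0)
    let ?d = "D x - (\<Sum>k<N. (-1) ^ k * (h (Suc k) - h k) * x ^ (2 * k + 2))"
    have "- (D x / (1 + x\<^sup>2)) - (\<Sum>k<Suc N. (-1) ^ k * h k * x ^ (2 * k))
        = - (?d + (-1) ^ N * h N * x ^ (2 * N + 2)) / (1 + x\<^sup>2)"
      using parts pos1[of x] by (simp add: field_simps del: sum.lessThan_Suc)
    also have "\<bar>\<dots>\<bar> \<le> \<bar>?d + (-1) ^ N * h N * x ^ (2 * N + 2)\<bar>"
    proof -
      have "\<bar>y / (1 + x\<^sup>2)\<bar> \<le> \<bar>y\<bar>" for y
        using pos1[of x] mult_left_mono[of 1 "1 + x\<^sup>2" "\<bar>y\<bar>"] by (simp add: abs_divide field_simps)
      from this[of "- (?d + (-1) ^ N * h N * x ^ (2 * N + 2))"] show ?thesis by simp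
    qed
    also have "\<dots> \<le> \<bar>?d\<bar> + \<bar>(-1) ^ N * h N * x ^ (2 * N + 2)\<bar>"
      by (rule abs_triangle_ineq)
    also have "\<dots> \<le> e N + h N * x ^ (2 * N + 2)"
      using D[OF x, of N] h_nonneg[of N] x by (simp add: abs_mult power_abs)
    finally show "\<bar>- (D x / (1 + x\<^sup>2)) - (\<Sum>k<Suc N. (-1) ^ k * h k * x ^ (2 * k))\<bar>
        \<le> e N + h N * x ^ (2 * N + 2)" .
  next
    show "(\<lambda>N. e N + h N * (1 / real (Suc (2 * N + 2)))) \<longlonglongrightarrow> 0"
      using tendsto_add[OF e h_lim] by (simp add: add.commute add.left_commute)
  qed
  then show ?thesis
    unfolding sums_def by (rule LIMSEQ_imp_Suc)
qed

lemma alternating_harm_sums: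
  "(\<lambda>k. (-1) ^ k / (2 * real k + 1) * shifted_harm 1 k) sums (catalan_const - pi / 2 * ln 2)"
proof -
  have "(\<lambda>k. (-1) ^ k / (2 * real k + 1) * shifted_harm 1 k) sums (- (pi / 2 * ln 2 - catalan_const))"
  proof (rule alternating_sum_via_integral[OF _ _ _ _ _ has_integral_ln_one_plus_square])
    show "(\<lambda>N. 1 / real (N + 1)) \<longlonglongrightarrow> 0" by real_asymp
    fix N and x :: real assume x: "0 \<le> x" "x \<le> 1"
    have "x ^ (2 * N + 2) / real (N + 1) \<le> 1 / real (N + 1)"
      using x by (intro divide_right_mono power_le_one) auto
    with ln_one_plus_square_partial_sum_error[OF x(1), of N]
    show "\<bar>ln (1 + x\<^sup>2) - (\<Sum>k<N. (-1) ^ k * (shifted_harm 1 (Suc k) - shifted_harm 1 k) * x ^ (2 * k + 2))\<bar>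
        \<le> 1 / real (N + 1)"
      by (simp add: shifted_harm_Suc add.commute)
  qed (use shifted_harm_sublinear in \<open>simp_all add: shifted_harm_nonneg\<close>)
  then show ?thesis by simp
qed

lemma alternating_odd_harm_sums:
  "(\<lambda>k. (-1) ^ k / (2 * real k + 1) * shifted_harm (1 / 2) k) sums (pi / 4 * ln 2 - catalan_const)"
proof -
  have "(\<lambda>k. (-1) ^ k / (2 * real k + 1) * shifted_harm (1 / 2) k) sums (- (catalan_const - pi / 4 * ln 2))"
  proof (rule alternating_sum_via_integral[OF _ _ _ _ _ has_integral_two_x_arctan])
    show "(\<lambda>N. 2 * 1 * (1 / real (2 * N + 1))) \<longlonglongrightarrow> 0" by real_asymp
    fix N and x :: real assume x: "0 \<le> x" "x \<le> 1"
    have "2 * x * arctan x - (\<Sum>k<N. (-1) ^ k * (shifted_harm (1 / 2) (Suc k) - shifted_harm (1 / 2) k) * x ^ (2 * k + 2))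
        = 2 * x * (arctan x - (\<Sum>k<N. (-1) ^ k * x ^ (2 * k + 1) / real (2 * k + 1)))"
      unfolding right_diff_distrib sum_distrib_left
      by (intro arg_cong2[where f = "(-)"] sum.cong refl) (simp add: shifted_harm_Suc field_simps)
    also have "\<bar>\<dots>\<bar> \<le> 2 * 1 * (1 / real (2 * N + 1))"
    proof -
      have "x ^ (2 * N + 1) / real (2 * N + 1) \<le> 1 / real (2 * N + 1)"
        using x by (intro divide_right_mono power_le_one) auto
      with arctan_partial_sum_error[OF x(1), of N] x show ?thesis
        unfolding abs_mult by (intro mult_mono) auto
    qed
    finally show "\<bar>2 * x * arctan x - (\<Sum>k<N. (-1) ^ k * (shifted_harm (1 / 2) (Suc k) - shifted_harm (1 / 2) k) * x ^ (2 * k + 2))\<bar>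
        \<le> 2 * 1 * (1 / real (2 * N + 1))" .
  qed (use shifted_harm_sublinear in \<open>simp_all add: shifted_harm_nonneg\<close>)
  then show ?thesis by simp
qed

section \<open>A Wilf-Zeilberger pair with four parameters\<close>

text \<open>For \<open>n = 0\<close> this is the term of the alternating very-well-poised series. The remaining factors are
chosen so that, up to constant factors, increasing \<open>n\<close> by one acts as the parameter shift
\<open>(a,b,c,d) \<mapsto> (a+3, b+2, c+2, d)\<close>, and increasing \<open>k\<close> by one as
\<open>(a,b,c,d) \<mapsto> (a+2, b+1, c+1, d+1)\<close>.\<close>

definition wzF :: "real \<Rightarrow> real \<Rightarrow> real \<Rightarrow> real \<Rightarrow> nat \<Rightarrow> nat \<Rightarrow> real" where
  "wzF a b c d n k =
     (-1) ^ k * (a + 3 * real n + 2 * real k) *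
     (pochhammer b (2 * n + k) * pochhammer c (2 * n + k) * pochhammer d k *
      pochhammer (1 + a - b - d) n * pochhammer (1 + a - c - d) n) /
     (pochhammer (1 + a - b) (n + k) * pochhammer (1 + a - c) (n + k) *
      pochhammer (1 + a - d) (3 * n + k) * pochhammer (b + c - a) n)"

text \<open>The rational certificate \<open>G / F\<close>. Since both indices act as parameter shifts, one function of four
variables serves for all \<open>n\<close> and \<open>k\<close>. The quantities \<open>1 + a - b - d\<close>,
\<open>1 + a - c - d\<close> and \<open>b + c - a\<close> do not change with \<open>k\<close>, so this form shows that the
certificate stays bounded as \<open>k\<close> grows.\<close>

definition wzR :: "real \<Rightarrow> real \<Rightarrow> real \<Rightarrow> real \<Rightarrow> real" where
  "wzR a b c d = 1 - b * c / (a * (1 + a - d)) *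
     (1 + (1 + a - b - d) * (1 + a - c - d) / ((b + c - a) * (2 + a - d)))"

definition wzG :: "real \<Rightarrow> real \<Rightarrow> real \<Rightarrow> real \<Rightarrow> nat \<Rightarrow> nat \<Rightarrow> real" where
  "wzG a b c d n k = wzF a b c d n k *
     wzR (a + 3 * real n + 2 * real k) (b + 2 * real n + real k) (c + 2 * real n + real k) (d + real k)"

definition wz_ratio_n :: "real \<Rightarrow> real \<Rightarrow> real \<Rightarrow> real \<Rightarrow> real" where
  "wz_ratio_n a b c d = (a + 3) * (b * (b + 1) * c * (c + 1) * (1 + a - b - d) * (1 + a - c - d)) /
     (a * ((1 + a - b) * (1 + a - c) * ((1 + a - d) * (2 + a - d) * (3 + a - d)) * (b + c - a)))"

definition wz_ratio_k :: "real \<Rightarrow> real \<Rightarrow> real \<Rightarrow> real \<Rightarrow> real" where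
  "wz_ratio_k a b c d = - ((a + 2) * (b * c * d) / (a * ((1 + a - b) * (1 + a - c) * (1 + a - d))))"

text \<open>The relation between \<open>F\<close> and \<open>G\<close>, divided by \<open>F(n,k)\<close>. After multiplication by the
common denominator \<open>D\<close> it becomes a polynomial identity in \<open>a, b, c, d\<close>.\<close>

lemma wz_certificate:
  assumes "a > 0" "1 + a - b > 0" "1 + a - c > 0" "1 + a - d > 0" "b + c - a > 0"
  shows "wz_ratio_n a b c d - 1 =
           wz_ratio_k a b c d * wzR (a + 2) (b + 1) (c + 1) (d + 1) - wzR a b c d"
proof -
  define p q t h where "p = 1 + a - b" and "q = 1 + a - c" and "t = 1 + a - d" and "h = b + c - a"
  define X Y where "X = 1 + a - b - d" and "Y = 1 + a - c - d"
  define D where "D = a * p * q * t * (t + 1) * (t + 2) * h"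
  have pos: "a > 0" "p > 0" "q > 0" "t > 0" "h > 0"
    using assms by (simp_all add: p_def q_def t_def h_def)
  then have D: "D > 0" by (simp add: D_def)
  \<comment> \<open>The certificate over its common denominator, at the two points where it is needed.\<close>
  have quotient_form: "1 - v / (u * t1) * (1 + x / (h * t2)) = (u * t1 * t2 * h - v * (t2 * h + x)) / (u * t1 * t2 * h)"
    if "u > 0" "t1 > 0" "t2 > 0" "h > 0" for u v t1 t2 x h :: real
    using that by (simp add: field_simps)
  have "D * wz_ratio_n a b c d = (a + 3) * (b * (b + 1) * c * (c + 1) * X * Y)"
  proof -
    have "wz_ratio_n a b c d = (a + 3) * (b * (b + 1) * c * (c + 1) * X * Y) / D"
      unfolding wz_ratio_n_def D_def p_def q_def t_def h_def X_def Y_def by (simp add: algebra_simps)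
    then show ?thesis using D by simp
  qed
  moreover have "D * (wz_ratio_k a b c d * wzR (a + 2) (b + 1) (c + 1) (d + 1)) =
      - (b * c * d) * ((a + 2) * (t + 1) * (t + 2) * h - (b + 1) * (c + 1) * ((t + 2) * h + X * Y))"
  proof -
    have R: "wzR (a + 2) (b + 1) (c + 1) (d + 1) =
        1 - (b + 1) * (c + 1) / ((a + 2) * (t + 1)) * (1 + X * Y / (h * (t + 2)))"
      unfolding wzR_def t_def h_def X_def Y_def by (simp add: algebra_simps)
    have r: "wz_ratio_k a b c d = - ((a + 2) * (b * c * d) / (a * (p * q * t)))"
      unfolding wz_ratio_k_def t_def p_def q_def by simp
    have cancel: "u * p * q * t * t1 * t2 * h * (- (u2 * m / (u * (p * q * t))) * (N / (u2 * t1 * t2 * h))) = - m * N"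
      if "u > 0" "u2 > 0" "t1 > 0" "t2 > 0" for u u2 t1 t2 m N :: real
      using that pos by (simp add: field_simps)
    have "a + 2 > 0" "t + 1 > 0" "t + 2 > 0" using pos by auto
    then show ?thesis
      unfolding R r D_def using pos by (subst quotient_form) (simp_all only: cancel)
  qed
  moreover have "D * wzR a b c d = p * q * (t + 2) * (a * t * (t + 1) * h - b * c * ((t + 1) * h + X * Y))"
  proof -
    have R: "wzR a b c d = 1 - b * c / (a * t) * (1 + X * Y / (h * (t + 1)))"
      unfolding wzR_def t_def h_def X_def Y_def by (simp add: algebra_simps)
    have cancel: "u * p * q * t * t1 * t2 * h * (N / (u * t * t1 * h)) = p * q * t2 * N"
      if "u > 0" "t1 > 0" for u t1 t2 N :: real
      using that pos by (simp add: field_simps)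
    have "t + 1 > 0" using pos by auto
    then show ?thesis
      unfolding R D_def using pos by (subst quotient_form) (simp_all only: cancel)
  qed
  moreover have "(a + 3) * (b * (b + 1) * c * (c + 1) * X * Y) - D =
      - (b * c * d) * ((a + 2) * (t + 1) * (t + 2) * h - (b + 1) * (c + 1) * ((t + 2) * h + X * Y))
      - p * q * (t + 2) * (a * t * (t + 1) * h - b * c * ((t + 1) * h + X * Y))"
    unfolding D_def X_def Y_def p_def q_def t_def h_def by algebra
  ultimately have "D * (wz_ratio_n a b c d - 1) =
      D * (wz_ratio_k a b c d * wzR (a + 2) (b + 1) (c + 1) (d + 1) - wzR a b c d)"
    by (simp add: right_diff_distrib)
  with D show ?thesis by simp
qed

lemma wzF_Suc_n:
  assumes "a > 0" "1 + a - b > 0" "1 + a - c > 0" "1 + a - d > 0" "b + c - a > 0"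
  shows "wzF a b c d (Suc n) k = wzF a b c d n k *
     wz_ratio_n (a + 3 * real n + 2 * real k) (b + 2 * real n + real k) (c + 2 * real n + real k) (d + real k)"
proof -
  have s: "2 * Suc n + k = Suc (Suc (2 * n + k))" "Suc n + k = Suc (n + k)"
    "3 * Suc n + k = Suc (Suc (Suc (3 * n + k)))"
    by simp_all
  have nz: "pochhammer (1 + a - b) (n + k) \<noteq> 0" "pochhammer (1 + a - c) (n + k) \<noteq> 0"
    "pochhammer (1 + a - d) (3 * n + k) \<noteq> 0" "pochhammer (b + c - a) n \<noteq> 0"
    using assms by (simp_all add: pochhammer_pos less_imp_neq[symmetric])
  define A B C D where "A = a + 3 * real n + 2 * real k" and "B = b + 2 * real n + real k"
    and "C = c + 2 * real n + real k" and "D = d + real k"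
  note ABCD = A_def B_def C_def D_def
  have nz2: "A \<noteq> 0"
    using assms by (simp add: A_def add_pos_nonneg less_imp_neq[symmetric])
  have e0: "1 + A - B - D = 1 + a - b - d + real n" "1 + A - C - D = 1 + a - c - d + real n"
    by (simp_all add: ABCD)
  have e1: "1 + A - B = 1 + a - b + real (n + k)" "1 + A - C = 1 + a - c + real (n + k)"
    "1 + A - D = 1 + a - d + real (3 * n + k)"
    "2 + A - D = 1 + a - d + real (Suc (3 * n + k))"
    "3 + A - D = 1 + a - d + real (Suc (Suc (3 * n + k)))"
    "B + C - A = b + c - a + real n"
    by (simp_all add: ABCD)
  have e2: "B = b + real (2 * n + k)" "C = c + real (2 * n + k)"
    by (simp_all add: ABCD)
  have e3: "B + 1 = b + real (Suc (2 * n + k))" "C + 1 = c + real (Suc (2 * n + k))"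
    by (simp_all add: ABCD)
  have r: "wz_ratio_n A B C D =
      (A + 3) * ((b + real (2 * n + k)) * (b + real (Suc (2 * n + k))) *
        (c + real (2 * n + k)) * (c + real (Suc (2 * n + k))) *
        (1 + a - b - d + real n) * (1 + a - c - d + real n)) /
      (A * ((1 + a - b + real (n + k)) * (1 + a - c + real (n + k)) *
        ((1 + a - d + real (3 * n + k)) * (1 + a - d + real (Suc (3 * n + k))) *
         (1 + a - d + real (Suc (Suc (3 * n + k))))) * (b + c - a + real n)))"
    unfolding wz_ratio_n_def e0 unfolding e1 e3 unfolding e2 ..
  have A: "a + 3 * real (Suc n) + 2 * real k = A + 3"
    by (simp add: A_def)
  show ?thesis
    unfolding wzF_def s pochhammer_Suc A ABCD[symmetric] r
    using nz nz2 by (simp add: divide_simps del: of_nat_Suc of_nat_add of_nat_mult)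
qed

lemma wzF_Suc_k:
  assumes "a > 0" "1 + a - b > 0" "1 + a - c > 0" "1 + a - d > 0" "b + c - a > 0"
  shows "wzF a b c d n (Suc k) = wzF a b c d n k *
     wz_ratio_k (a + 3 * real n + 2 * real k) (b + 2 * real n + real k) (c + 2 * real n + real k) (d + real k)"
proof -
  define A B C D where "A = a + 3 * real n + 2 * real k" and "B = b + 2 * real n + real k"
    and "C = c + 2 * real n + real k" and "D = d + real k"
  note ABCD = A_def B_def C_def D_def
  have nz2: "A \<noteq> 0"
    using assms by (simp add: A_def add_pos_nonneg less_imp_neq[symmetric])
  have e1: "1 + A - B = 1 + a - b + real (n + k)" "1 + A - C = 1 + a - c + real (n + k)"
    "1 + A - D = 1 + a - d + real (3 * n + k)"
    by (simp_all add: ABCD)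
  have e2: "B = b + real (2 * n + k)" "C = c + real (2 * n + k)"
    by (simp_all add: ABCD)
  have r: "wz_ratio_k A B C D =
      - ((A + 2) * ((b + real (2 * n + k)) * (c + real (2 * n + k)) * D) /
      (A * ((1 + a - b + real (n + k)) * (1 + a - c + real (n + k)) * (1 + a - d + real (3 * n + k)))))"
    unfolding wz_ratio_k_def e1 unfolding e2 ..
  have A: "a + 3 * real n + 2 * real (Suc k) = A + 2"
    by (simp add: A_def)
  show ?thesis
    unfolding wzF_def add_Suc_right pochhammer_Suc power_Suc A ABCD[symmetric] r
    using nz2 by (simp add: divide_simps del: of_nat_Suc of_nat_add of_nat_mult)
qed

lemma wz_pair:
  assumes "a > 0" "1 + a - b > 0" "1 + a - c > 0" "1 + a - d > 0" "b + c - a > 0"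
  shows "wzF a b c d (Suc n) k - wzF a b c d n k = wzG a b c d n (Suc k) - wzG a b c d n k"
proof -
  define A B C D where "A = a + 3 * real n + 2 * real k" and "B = b + 2 * real n + real k"
    and "C = c + 2 * real n + real k" and "D = d + real k"
  have "wz_ratio_n A B C D - 1 = wz_ratio_k A B C D * wzR (A + 2) (B + 1) (C + 1) (D + 1) - wzR A B C D"
    using assms by (intro wz_certificate) (simp_all add: A_def B_def C_def D_def algebra_simps add_pos_nonneg)
  then have "wzF a b c d n k * (wz_ratio_n A B C D - 1) =
      wzF a b c d n k * (wz_ratio_k A B C D * wzR (A + 2) (B + 1) (C + 1) (D + 1) - wzR A B C D)"
    by simp
  then show ?thesis
    unfolding wzG_def wzF_Suc_n[OF assms] wzF_Suc_k[OF assms]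
    by (simp add: A_def B_def C_def D_def algebra_simps)
qed

text \<open>Summing the relation over a rectangle compares its four sides. The side at \<open>k = K\<close> vanishes as
\<open>K\<close> tends to infinity with \<open>n\<close> fixed; the side at \<open>n = N\<close> is an infinite series,
dominated by \<open>B N\<close> times a convergent one.\<close>

lemma sums_via_wz_pair:
  fixes F G :: "nat \<Rightarrow> nat \<Rightarrow> real"
  assumes pair: "\<And>n k. F (Suc n) k - F n k = G n (Suc k) - G n k"
    and F0: "F 0 sums S"
    and G: "\<And>n. G n \<longlonglongrightarrow> 0"
    and bound: "\<And>n k. n \<ge> n0 \<Longrightarrow> \<bar>F n k\<bar> \<le> B n * c k"
    and B: "B \<longlonglongrightarrow> 0" and c: "summable c" "\<And>k. 0 \<le> c k" and B_nonneg: "\<And>n. 0 \<le> B n"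
  shows "(\<lambda>n. G n 0) sums S"
proof -
  \<comment> \<open>Row N of the rectangle, expressed by row 0 and the two columns.\<close>
  have rect: "(\<Sum>k<K. F N k) = (\<Sum>k<K. F 0 k) + (\<Sum>n<N. G n K) - (\<Sum>n<N. G n 0)" for N K
  proof (induction N)
    case (Suc N)
    have "(\<Sum>k<K. F (Suc N) k - F N k) = G N K - G N 0"
      by (simp add: pair sum_lessThan_telescope)
    then show ?case using Suc by (simp add: sum_subtractf)
  qed simp
  \<comment> \<open>As K grows the column at K disappears.\<close>
  have row: "(\<lambda>K. \<Sum>k<K. F N k) \<longlonglongrightarrow> S - (\<Sum>n<N. G n 0)" for N
  proof -
    have "(\<lambda>K. \<Sum>n<N. G n K) \<longlonglongrightarrow> (\<Sum>n<N. 0)"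
      using G by (intro tendsto_sum) simp
    moreover have "(\<lambda>K. \<Sum>k<K. F 0 k) \<longlonglongrightarrow> S"
      using F0 by (simp add: sums_def)
    ultimately have "(\<lambda>K. (\<Sum>k<K. F 0 k) + (\<Sum>n<N. G n K) - (\<Sum>n<N. G n 0)) \<longlonglongrightarrow>
        S + (\<Sum>n<N. 0) - (\<Sum>n<N. G n 0)"
      by (intro tendsto_diff tendsto_add tendsto_const)
    then show ?thesis by (simp add: rect[of N])
  qed
  have "\<bar>S - (\<Sum>n<N. G n 0)\<bar> \<le> B N * suminf c" if N: "N \<ge> n0" for N
  proof (rule LIMSEQ_le_const2)
    show "(\<lambda>K. \<bar>\<Sum>k<K. F N k\<bar>) \<longlonglongrightarrow> \<bar>S - (\<Sum>n<N. G n 0)\<bar>"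
      by (rule tendsto_rabs[OF row])
    have "\<bar>\<Sum>k<K. F N k\<bar> \<le> B N * suminf c" for K
    proof -
      have "\<bar>\<Sum>k<K. F N k\<bar> \<le> (\<Sum>k<K. B N * c k)"
        using bound[OF N] by (intro order_trans[OF sum_abs] sum_mono) auto
      also have "\<dots> = B N * (\<Sum>k<K. c k)"
        by (simp add: sum_distrib_left)
      also have "\<dots> \<le> B N * suminf c"
        using c B_nonneg by (intro mult_left_mono sum_le_suminf) auto
      finally show ?thesis .
    qed
    then show "\<exists>M. \<forall>K\<ge>M. \<bar>\<Sum>k<K. F N k\<bar> \<le> B N * suminf c"
      by blast
  qed
  then have "\<forall>\<^sub>F N in sequentially. norm ((\<Sum>n<N. G n 0) - S) \<le> B N * suminf c"
    unfolding eventually_sequentially by (auto simp: abs_minus_commute)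
  moreover have "(\<lambda>N. B N * suminf c) \<longlonglongrightarrow> 0"
    using tendsto_mult_right[OF B, of "suminf c"] by simp
  ultimately have "(\<lambda>N. (\<Sum>n<N. G n 0) - S) \<longlonglongrightarrow> 0"
    by (rule Lim_null_comparison)
  then show ?thesis
    unfolding sums_def by (rule LIM_zero_cancel)
qed

section \<open>Differentiating the pair\<close>

text \<open>Logarithmic derivatives without logarithms: \<open>f\<close> may be negative at \<open>x\<close>, as the terms of the
pair are for odd \<open>k\<close>.\<close>

definition has_logderiv :: "(real \<Rightarrow> real) \<Rightarrow> real \<Rightarrow> real \<Rightarrow> bool" where
  "has_logderiv f l x \<longleftrightarrow> (f has_real_derivative f x * l) (at x)"

lemma has_logderiv_const: "has_logderiv (\<lambda>_. c) 0 x"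
  by (simp add: has_logderiv_def)

lemma has_logderiv_mult:
  "has_logderiv f l x \<Longrightarrow> has_logderiv g l' x \<Longrightarrow> has_logderiv (\<lambda>e. f e * g e) (l + l') x"
  unfolding has_logderiv_def by (drule (1) DERIV_mult) (simp add: algebra_simps)

lemma has_logderiv_divide:
  assumes "has_logderiv f l x" "has_logderiv g l' x" "g x \<noteq> 0"
  shows "has_logderiv (\<lambda>e. f e / g e) (l - l') x"
proof -
  have "((\<lambda>e. f e / g e) has_real_derivative (f x * l * g x - f x * (g x * l')) / (g x * g x)) (at x)"
    using assms unfolding has_logderiv_def by (intro DERIV_divide) auto
  also have "(f x * l * g x - f x * (g x * l')) / (g x * g x) = f x / g x * (l - l')"
    using assms(3) by (simp add: field_simps)
  finally show ?thesis by (simp add: has_logderiv_def)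
qed

lemma has_logderiv_affine:
  assumes "x \<noteq> 0"
  shows "has_logderiv (\<lambda>e. x + t * e) (t / x) 0"
  unfolding has_logderiv_def using assms by (auto intro!: derivative_eq_intros)

text \<open>This is where the harmonic numbers come from.\<close>

lemma has_logderiv_pochhammer:
  assumes "x > 0"
  shows "has_logderiv (\<lambda>e. pochhammer (x + t * e) k) (t * shifted_harm x k) 0"
proof (induction k)
  case 0
  show ?case by (simp add: has_logderiv_const)
next
  case (Suc k)
  have "has_logderiv (\<lambda>e. x + real k + t * e) (t / (x + real k)) 0"
    using assms by (intro has_logderiv_affine) simp
  from has_logderiv_mult[OF Suc this] show ?case
    by (simp add: pochhammer_Suc shifted_harm_Suc algebra_simps)
qed

lemma eventually_affine_pos:
  fixes x t :: real
  assumes "x > 0"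
  shows "\<forall>\<^sub>F e in nhds 0. x + t * e > 0"
proof -
  have "((\<lambda>e. x + t * e) \<longlongrightarrow> x + t * 0) (nhds 0)"
    by (intro tendsto_intros filterlim_ident)
  then show ?thesis
    using assms by (intro order_tendstoD(1)) auto
qed

lemma wzR_directional_derivative:
  fixes A B C D u w z :: real
  assumes "A \<noteq> 0" "C \<noteq> 0" "1 + A - D \<noteq> 0" "2 + A - D \<noteq> 0" "B + C - A \<noteq> 0"
    "1 + A - B - D \<noteq> 0" "1 + A - C - D \<noteq> 0"
  defines "W \<equiv> (1 + A - B - D) * (1 + A - C - D) / ((B + C - A) * (2 + A - D))"
  shows "((\<lambda>e. wzR (A + u * e) B (C + w * e) (D + z * e)) has_real_derivative
           - (B * C / (A * (1 + A - D))) *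
             ((w / C - u / A - (u - z) / (1 + A - D)) * (1 + W) +
              W * ((u - z) / (1 + A - B - D) + (u - w - z) / (1 + A - C - D)
                   - (w - u) / (B + C - A) - (u - z) / (2 + A - D)))) (at 0)"
proof -
  define P where "P e = B * (C + w * e) / ((A + u * e) * (1 + A - D + (u - z) * e))" for e
  define V where "V e = (1 + A - B - D + (u - z) * e) * (1 + A - C - D + (u - w - z) * e) /
      ((B + C - A + (w - u) * e) * (2 + A - D + (u - z) * e))" for e
  define p lP lV where "p = B * C / (A * (1 + A - D))"
    and "lP = w / C - u / A - (u - z) / (1 + A - D)"
    and "lV = (u - z) / (1 + A - B - D) + (u - w - z) / (1 + A - C - D)
                - (w - u) / (B + C - A) - (u - z) / (2 + A - D)"
  have P0: "P 0 = p" and V0: "V 0 = W"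
    by (simp_all add: P_def V_def W_def p_def)
  have "has_logderiv P ((0 + w / C) - (u / A + (u - z) / (1 + A - D))) 0"
    unfolding P_def using assms(1-7)
    by (intro has_logderiv_divide has_logderiv_mult has_logderiv_const has_logderiv_affine) auto
  then have P: "(P has_real_derivative p * lP) (at 0)"
    by (simp add: has_logderiv_def P0 lP_def diff_diff_eq)
  have "has_logderiv V (((u - z) / (1 + A - B - D) + (u - w - z) / (1 + A - C - D))
      - ((w - u) / (B + C - A) + (u - z) / (2 + A - D))) 0"
    unfolding V_def using assms(1-7)
    by (intro has_logderiv_divide has_logderiv_mult has_logderiv_const has_logderiv_affine) auto
  then have V: "(V has_real_derivative W * lV) (at 0)"
    by (simp add: has_logderiv_def V0 lV_def diff_diff_eq)
  have eq: "wzR (A + u * e) B (C + w * e) (D + z * e) = 1 - P e * (1 + V e)" for e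
    unfolding wzR_def P_def V_def by (simp add: algebra_simps)
  have "((\<lambda>e. 1 - P e * (1 + V e)) has_real_derivative
      (0 - (p * lP * (1 + V 0) + (0 + W * lV) * P 0))) (at 0)"
    by (intro DERIV_diff DERIV_mult DERIV_add DERIV_const P V)
  also have "0 - (p * lP * (1 + V 0) + (0 + W * lV) * P 0) = - p * (lP * (1 + W) + W * lV)"
    by (simp add: P0 V0 algebra_simps)
  finally show ?thesis
    unfolding eq p_def lP_def lV_def .
qed

text \<open>The line through the base point \<open>(1, 1/2, 1, 1/2)\<close> has direction \<open>(u, 0, w, z)\<close>. The factor
\<open>1 + m e\<close> adds \<open>m\<close> times the undifferentiated pair to its derivative; this is used to cancel
the constants that the passage between half-integer arguments of \<^const>\<open>shifted_harm\<close> produces.\<close>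

context
  fixes m u w z :: real
begin

definition perturbed_F :: "real \<Rightarrow> nat \<Rightarrow> nat \<Rightarrow> real" where
  "perturbed_F e n k = (1 + m * e) * wzF (1 + u * e) (1 / 2) (1 + w * e) (1 / 2 + z * e) n k"

definition perturbed_G :: "real \<Rightarrow> nat \<Rightarrow> nat \<Rightarrow> real" where
  "perturbed_G e n k = (1 + m * e) * wzG (1 + u * e) (1 / 2) (1 + w * e) (1 / 2 + z * e) n k"

definition F_logderiv :: "nat \<Rightarrow> nat \<Rightarrow> real" where
  "F_logderiv n k = m + u / (1 + 3 * real n + 2 * real k)
     + w * shifted_harm 1 (2 * n + k) + z * shifted_harm (1 / 2) k
     + (u - z) * shifted_harm 1 n + (u - w - z) * shifted_harm (1 / 2) n
     - u * shifted_harm (3 / 2) (n + k) - (u - w) * shifted_harm 1 (n + k)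
     - (u - z) * shifted_harm (3 / 2) (3 * n + k) - (w - u) * shifted_harm (1 / 2) n"

definition base_R :: "nat \<Rightarrow> nat \<Rightarrow> real" where
  "base_R n k = wzR (1 + 3 * real n + 2 * real k) (1 / 2 + 2 * real n + real k)
     (1 + 2 * real n + real k) (1 / 2 + real k)"

text \<open>The derivative at \<open>e = 0\<close> of the certificate along the line. It is nested as in
\<open>wzR_directional_derivative\<close>, with the base values \<open>1 + n\<close>, \<open>1/2 + n\<close> and
\<open>1/2 + n\<close> of the three quantities that are constant in \<open>k\<close>.\<close>

definition R_deriv :: "nat \<Rightarrow> nat \<Rightarrow> real" where
  "R_deriv n k =
     - ((1 / 2 + 2 * real n + real k) * (1 + 2 * real n + real k) /
        ((1 + 3 * real n + 2 * real k) * (3 / 2 + 3 * real n + real k))) *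
     ((w / (1 + 2 * real n + real k) - u / (1 + 3 * real n + 2 * real k)
         - (u - z) / (3 / 2 + 3 * real n + real k)) * (1 + (1 + real n) / (5 / 2 + 3 * real n + real k)) +
      (1 + real n) / (5 / 2 + 3 * real n + real k) *
        ((u - z) / (1 + real n) + (u - w - z) / (1 / 2 + real n) - (w - u) / (1 / 2 + real n)
         - (u - z) / (5 / 2 + 3 * real n + real k)))"

definition deriv_F :: "nat \<Rightarrow> nat \<Rightarrow> real" where
  "deriv_F n k = wzF 1 (1 / 2) 1 (1 / 2) n k * F_logderiv n k"

definition deriv_G :: "nat \<Rightarrow> nat \<Rightarrow> real" where
  "deriv_G n k = wzF 1 (1 / 2) 1 (1 / 2) n k * (F_logderiv n k * base_R n k + R_deriv n k)"

lemma perturbed_F_has_derivative: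
  "((\<lambda>e. perturbed_F e n k) has_real_derivative deriv_F n k) (at 0)"
proof -
  have eq: "perturbed_F e n k = (1 + m * e) *
      ((-1) ^ k * (1 + 3 * real n + 2 * real k + u * e) *
       (pochhammer (1 / 2) (2 * n + k) * pochhammer (1 + w * e) (2 * n + k) * pochhammer (1 / 2 + z * e) k *
        pochhammer (1 + (u - z) * e) n * pochhammer (1 / 2 + (u - w - z) * e) n) /
       (pochhammer (3 / 2 + u * e) (n + k) * pochhammer (1 + (u - w) * e) (n + k) *
        pochhammer (3 / 2 + (u - z) * e) (3 * n + k) * pochhammer (1 / 2 + (w - u) * e) n))" for e
  proof -
    have "1 + (1 + u * e) - 1 / 2 - (1 / 2 + z * e) = 1 + (u - z) * e"
      "1 + (1 + u * e) - (1 + w * e) - (1 / 2 + z * e) = 1 / 2 + (u - w - z) * e"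
      "1 + (1 + u * e) - 1 / 2 = 3 / 2 + u * e"
      "1 + (1 + u * e) - (1 + w * e) = 1 + (u - w) * e"
      "1 + (1 + u * e) - (1 / 2 + z * e) = 3 / 2 + (u - z) * e"
      "1 / 2 + (1 + w * e) - (1 + u * e) = 1 / 2 + (w - u) * e"
      "1 + u * e + 3 * real n + 2 * real k = 1 + 3 * real n + 2 * real k + u * e"
      by (simp_all add: algebra_simps)
    then show ?thesis
      unfolding perturbed_F_def wzF_def by (simp only:)
  qed
  have "has_logderiv (\<lambda>e. perturbed_F e n k)
      (m / 1 + ((0 + u / (1 + 3 * real n + 2 * real k)) +
       (0 + w * shifted_harm 1 (2 * n + k) + z * shifted_harm (1 / 2) k +
        (u - z) * shifted_harm 1 n + (u - w - z) * shifted_harm (1 / 2) n) -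
       (u * shifted_harm (3 / 2) (n + k) + (u - w) * shifted_harm 1 (n + k) +
        (u - z) * shifted_harm (3 / 2) (3 * n + k) + (w - u) * shifted_harm (1 / 2) n))) 0"
    unfolding eq
    by (intro has_logderiv_divide has_logderiv_mult has_logderiv_const has_logderiv_affine
        has_logderiv_pochhammer) (simp_all add: pochhammer_pos less_imp_neq[symmetric])
  then have "((\<lambda>e. perturbed_F e n k) has_real_derivative perturbed_F 0 n k * F_logderiv n k) (at 0)"
    unfolding has_logderiv_def by (simp add: F_logderiv_def algebra_simps)
  then show ?thesis
    by (simp add: deriv_F_def perturbed_F_def)
qed

lemma perturbed_G_has_derivative:
  "((\<lambda>e. perturbed_G e n k) has_real_derivative deriv_G n k) (at 0)"
proof -
  define A B C D where "A = 1 + 3 * real n + 2 * real k" and "B = 1 / 2 + 2 * real n + real k"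
    and "C = 1 + 2 * real n + real k" and "D = 1 / 2 + real k"
  have eqs: "1 + A - B - D = 1 + real n" "1 + A - C - D = 1 / 2 + real n"
    "1 + A - D = 3 / 2 + 3 * real n + real k" "2 + A - D = 5 / 2 + 3 * real n + real k"
    "B + C - A = 1 / 2 + real n"
    by (simp_all add: A_def B_def C_def D_def)
  have W: "(1 + real n) * (1 / 2 + real n) / ((1 / 2 + real n) * (5 / 2 + 3 * real n + real k))
      = (1 + real n) / (5 / 2 + 3 * real n + real k)"
    by simp
  have pos: "A > 0" "C > 0" by (simp_all add: A_def C_def add_pos_nonneg)
  have R: "((\<lambda>e. wzR (A + u * e) B (C + w * e) (D + z * e)) has_real_derivative R_deriv n k) (at 0)"
  proof -
    have "((\<lambda>e. wzR (A + u * e) B (C + w * e) (D + z * e)) has_real_derivative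
           - (B * C / (A * (1 + A - D))) *
             ((w / C - u / A - (u - z) / (1 + A - D)) *
               (1 + (1 + A - B - D) * (1 + A - C - D) / ((B + C - A) * (2 + A - D))) +
              (1 + A - B - D) * (1 + A - C - D) / ((B + C - A) * (2 + A - D)) *
                ((u - z) / (1 + A - B - D) + (u - w - z) / (1 + A - C - D)
                   - (w - u) / (B + C - A) - (u - z) / (2 + A - D)))) (at 0)"
      using pos unfolding eqs
      by (intro wzR_directional_derivative[of A C D B, unfolded eqs]) (auto simp: add_pos_nonneg less_imp_neq[symmetric])
    then show ?thesis
      unfolding eqs W unfolding R_deriv_def A_def B_def C_def by simp
  qed
  have eq: "perturbed_G e n k = perturbed_F e n k * wzR (A + u * e) B (C + w * e) (D + z * e)" for e
  proof -
    have "1 + u * e + 3 * real n + 2 * real k = A + u * e" "1 / 2 + 2 * real n + real k = B"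
      "1 + w * e + 2 * real n + real k = C + w * e" "1 / 2 + z * e + real k = D + z * e"
      by (simp_all add: A_def B_def C_def D_def)
    then show ?thesis
      unfolding perturbed_G_def perturbed_F_def wzG_def by (simp only: mult.assoc)
  qed
  have "base_R n k = wzR A B C D"
    by (simp add: base_R_def A_def B_def C_def D_def)
  then show ?thesis
    unfolding eq
    using DERIV_mult[OF perturbed_F_has_derivative[of n k] R]
    by (simp add: deriv_F_def deriv_G_def perturbed_F_def algebra_simps)
qed

text \<open>Near \<open>e = 0\<close> all denominators stay positive, so both sides of the relation are the same
differentiable function of \<open>e\<close>.\<close>

lemma deriv_wz_pair: "deriv_F (Suc n) k - deriv_F n k = deriv_G n (Suc k) - deriv_G n k"
proof (rule DERIV_unique)
  show "((\<lambda>e. perturbed_F e (Suc n) k - perturbed_F e n k) has_real_derivative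
          deriv_F (Suc n) k - deriv_F n k) (at 0)"
    by (intro DERIV_diff perturbed_F_has_derivative)
  have "\<forall>\<^sub>F e in nhds 0. 0 < 1 + u * e" "\<forall>\<^sub>F e in nhds 0. 0 < 3 / 2 + u * e"
    "\<forall>\<^sub>F e in nhds 0. 0 < 1 + (u - w) * e" "\<forall>\<^sub>F e in nhds 0. 0 < 3 / 2 + (u - z) * e"
    "\<forall>\<^sub>F e in nhds 0. 0 < 1 / 2 + (w - u) * e"
    by (rule eventually_affine_pos, simp)+
  then have ev: "\<forall>\<^sub>F e in nhds 0. perturbed_G e n (Suc k) - perturbed_G e n k = perturbed_F e (Suc n) k - perturbed_F e n k"
  proof eventually_elim
    case (elim e)
    have "wzF (1 + u * e) (1 / 2) (1 + w * e) (1 / 2 + z * e) (Suc n) k - wzF (1 + u * e) (1 / 2) (1 + w * e) (1 / 2 + z * e) n k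
      = wzG (1 + u * e) (1 / 2) (1 + w * e) (1 / 2 + z * e) n (Suc k) - wzG (1 + u * e) (1 / 2) (1 + w * e) (1 / 2 + z * e) n k"
      using elim by (intro wz_pair) (simp_all add: algebra_simps)
    then show ?case
      by (simp add: perturbed_F_def perturbed_G_def flip: right_diff_distrib)
  qed
  have G: "((\<lambda>e. perturbed_G e n (Suc k) - perturbed_G e n k) has_real_derivative
          deriv_G n (Suc k) - deriv_G n k) (at 0)"
    by (intro DERIV_diff perturbed_G_has_derivative)
  show "((\<lambda>e. perturbed_F e (Suc n) k - perturbed_F e n k) has_real_derivative
          deriv_G n (Suc k) - deriv_G n k) (at 0)"
    by (rule iffD1[OF DERIV_cong_ev[OF refl ev refl] G])
qed

end

section \<open>Estimates at the base point\<close>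

abbreviation base_F :: "nat \<Rightarrow> nat \<Rightarrow> real" where
  "base_F \<equiv> wzF 1 (1 / 2) 1 (1 / 2)"

lemma pochhammer_three_halves: "pochhammer (3 / 2 :: real) k = (2 * real k + 1) * pochhammer (1 / 2) k"
  using pochhammer_rec[of "1 / 2 :: real" k] pochhammer_Suc[of "1 / 2 :: real" k] by (simp add: algebra_simps)

lemma base_F_0: "base_F 0 k = (-1) ^ k / (2 * real k + 1)"
proof -
  have "pochhammer (1 / 2 :: real) k > 0" "pochhammer (1 :: real) k > 0" "2 * real k + 1 > 0"
    by (simp_all add: pochhammer_pos)
  then show ?thesis
    by (simp add: wzF_def pochhammer_three_halves divide_simps)
qed

text \<open>Clearing the halves makes numerator and denominator products of natural numbers. Comparing such products
is easy after expansion, since all coefficients are nonnegative.\<close>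

lemma abs_base_F_Suc:
  "\<bar>base_F (Suc n) k\<bar> = \<bar>base_F n k\<bar> *
     (4 * real ((4 + 3 * n + 2 * k) * (1 + 4 * n + 2 * k) * (3 + 4 * n + 2 * k) * (1 + 2 * n + k) *
                (2 + 2 * n + k) * (n + 1)) /
      real ((1 + 3 * n + 2 * k) * (3 + 2 * n + 2 * k) * (1 + n + k) * (3 + 6 * n + 2 * k) *
            (5 + 6 * n + 2 * k) * (7 + 6 * n + 2 * k)))"
  (is "_ = _ * (4 * real ?num / real ?den)")
proof -
  define A B C D where "A = 1 + 3 * real n + 2 * real k" and "B = 1 / 2 + 2 * real n + real k"
    and "C = 1 + 2 * real n + real k" and "D = 1 / 2 + real k"
  have e0: "1 + A - B - D = real (n + 1)" "1 + A - C - D = 1 / 2 + real n"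
    by (simp_all add: A_def B_def C_def D_def)
  have e1: "1 + A - B = real (3 + 2 * n + 2 * k) / 2" "1 + A - C = real (1 + n + k)"
    "1 + A - D = real (3 + 6 * n + 2 * k) / 2" "2 + A - D = real (5 + 6 * n + 2 * k) / 2"
    "3 + A - D = real (7 + 6 * n + 2 * k) / 2" "B + C - A = 1 / 2 + real n"
    by (simp_all add: A_def B_def C_def D_def)
  have e2: "A + 3 = real (4 + 3 * n + 2 * k)" "B + 1 = real (3 + 4 * n + 2 * k) / 2"
    "C + 1 = real (2 + 2 * n + k)"
    by (simp_all add: A_def B_def C_def)
  have e3: "A = real (1 + 3 * n + 2 * k)" "B = real (1 + 4 * n + 2 * k) / 2"
    "C = real (1 + 2 * n + k)"
    by (simp_all add: A_def B_def C_def)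
  have nz: "1 / 2 + real n \<noteq> 0" by (simp add: add_pos_nonneg less_imp_neq[symmetric])
  have cancel: "a3 * (b / 2 * (b1 / 2) * c * c1 * x * h) / (a * (p / 2 * q * (r / 2 * (s / 2) * (t / 2)) * h))
      = 4 * (a3 * b * b1 * c * c1 * x) / (a * p * q * r * s * t)"
    if "h \<noteq> 0" for a a3 b b1 c c1 x h p q r s t :: real
    using that by (simp add: mult_ac)
  have "wz_ratio_n A B C D = 4 * real ?num / real ?den"
    unfolding wz_ratio_n_def e0 unfolding e1 e2 unfolding e3
    unfolding of_nat_mult using nz by (rule cancel)
  moreover have "base_F (Suc n) k = base_F n k * wz_ratio_n A B C D"
    unfolding A_def B_def C_def D_def by (rule wzF_Suc_n) simp_all
  ultimately show ?thesis by (simp add: abs_mult)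
qed

text \<open>For \<open>k = \<kappa> n\<close> and large \<open>n\<close> the ratio is close to
\<open>(2+\<kappa>)^4 / ((1+\<kappa>)^2 (3+\<kappa>)^3)\<close>, which is largest at \<open>\<kappa> = 0\<close> with the
value \<open>16/27\<close>. The constant \<open>3/4\<close> leaves enough room for the inequality to hold coefficient by
coefficient for all \<open>n\<close> and \<open>k\<close>.\<close>

lemma abs_base_F_Suc_le_geometric: "\<bar>base_F (Suc n) k\<bar> \<le> 3 / 4 * \<bar>base_F n k\<bar>"
proof -
  define num den where "num = (4 + 3 * n + 2 * k) * (1 + 4 * n + 2 * k) * (3 + 4 * n + 2 * k) *
      (1 + 2 * n + k) * (2 + 2 * n + k) * (n + 1)"
    and "den = (1 + 3 * n + 2 * k) * (3 + 2 * n + 2 * k) * (1 + n + k) * (3 + 6 * n + 2 * k) *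
      (5 + 6 * n + 2 * k) * (7 + 6 * n + 2 * k)"
  have "16 * num \<le> 3 * den"
    unfolding num_def den_def by (simp add: algebra_simps)
  then have "16 * real num \<le> 3 * real den"
    by (metis of_nat_le_iff of_nat_mult of_nat_numeral)
  moreover have "real den > 0" unfolding of_nat_0_less_iff by (simp add: den_def)
  ultimately have "4 * real num / real den \<le> 3 / 4"
    by (simp add: field_simps)
  then have "\<bar>base_F n k\<bar> * (4 * real num / real den) \<le> \<bar>base_F n k\<bar> * (3 / 4)"
    by (rule mult_left_mono) simp
  then show ?thesis
    unfolding num_def den_def abs_base_F_Suc by (simp add: mult.commute)
qed

text \<open>Each step in \<open>n\<close> also gains a factor \<open>1 / (k + 1)\<close>. Two steps turn the conditionally
convergent series over \<open>k\<close> at \<open>n = 0\<close> into one that converges absolutely even against the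
polynomial growth of the logarithmic derivative.\<close>

lemma abs_base_F_Suc_le_decay:
  "\<bar>base_F (Suc n) k\<bar> \<le> 2 * real (n + 1) / real (k + 1) * \<bar>base_F n k\<bar>"
proof -
  define num den where "num = (4 + 3 * n + 2 * k) * (1 + 4 * n + 2 * k) * (3 + 4 * n + 2 * k) *
      (1 + 2 * n + k) * (2 + 2 * n + k)"
    and "den = (1 + 3 * n + 2 * k) * (3 + 2 * n + 2 * k) * (1 + n + k) * (3 + 6 * n + 2 * k) *
      (5 + 6 * n + 2 * k) * (7 + 6 * n + 2 * k)"
  have "4 * num * (k + 1) \<le> 2 * den"
    unfolding num_def den_def by (simp add: algebra_simps)
  then have "4 * real num * real (k + 1) \<le> 2 * real den"
    by (metis of_nat_le_iff of_nat_mult of_nat_numeral)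
  moreover have "real den > 0" unfolding of_nat_0_less_iff by (simp add: den_def)
  ultimately have "4 * real num / real den \<le> 2 / real (k + 1)"
    by (simp add: field_simps)
  then have "4 * real num / real den * real (n + 1) \<le> 2 / real (k + 1) * real (n + 1)"
    by (rule mult_right_mono) simp
  then have "4 * real (num * (n + 1)) / real den \<le> 2 * real (n + 1) / real (k + 1)"
    by (simp only: of_nat_mult mult.assoc times_divide_eq_left times_divide_eq_right)
  then have "\<bar>base_F n k\<bar> * (4 * real (num * (n + 1)) / real den) \<le> \<bar>base_F n k\<bar> * (2 * real (n + 1) / real (k + 1))"
    by (rule mult_left_mono) simp
  then show ?thesis
    unfolding num_def den_def abs_base_F_Suc by (simp add: mult.commute)
qed

lemma abs_base_F_le: "\<bar>base_F n k\<bar> \<le> 1 / (2 * real k + 1)"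
proof (induction n)
  case 0
  then show ?case by (simp add: base_F_0 abs_divide power_abs)
next
  case (Suc n)
  then show ?case using abs_base_F_Suc_le_geometric[of n k] by linarith
qed

lemma abs_base_F_le_geometric:
  assumes "2 \<le> n"
  shows "\<bar>base_F n k\<bar> \<le> 128 / 9 * (3 / 4) ^ n / ((2 * real k + 1) * (real k + 1)\<^sup>2)"
  using assms
proof (induction n rule: nat_induct_at_least)
  case base
  have "\<bar>base_F 1 k\<bar> \<le> 2 / real (k + 1) * (1 / (2 * real k + 1))"
    using abs_base_F_Suc_le_decay[of 0 k] by (simp add: base_F_0 abs_divide power_abs)
  then have "4 / real (k + 1) * \<bar>base_F 1 k\<bar> \<le> 4 / real (k + 1) * (2 / real (k + 1) * (1 / (2 * real k + 1)))"
    by (intro mult_left_mono) auto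
  moreover have "\<bar>base_F 2 k\<bar> \<le> 4 / real (k + 1) * \<bar>base_F 1 k\<bar>"
    using abs_base_F_Suc_le_decay[of 1 k] by (simp add: numeral_2_eq_2)
  ultimately have "\<bar>base_F 2 k\<bar> \<le> 4 / real (k + 1) * (2 / real (k + 1) * (1 / (2 * real k + 1)))"
    by linarith
  also have "\<dots> = 128 / 9 * (3 / 4) ^ 2 / ((2 * real k + 1) * (real k + 1)\<^sup>2)"
    by (simp add: power2_eq_square add.commute mult_ac)
  finally show ?case .
next
  case (Suc n)
  have "3 / 4 * (128 / 9 * (3 / 4) ^ n / ((2 * real k + 1) * (real k + 1)\<^sup>2)) =
      128 / 9 * (3 / 4) ^ Suc n / ((2 * real k + 1) * (real k + 1)\<^sup>2)"
    by simp
  with Suc show ?case using abs_base_F_Suc_le_geometric[of n k] by linarith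
qed

lemma abs_scaled_shifted_harm_le:
  assumes "1 / 2 \<le> x" "real j \<le> y"
  shows "\<bar>c * shifted_harm x j\<bar> \<le> \<bar>c\<bar> * (4 * sqrt y)"
proof -
  have "shifted_harm x j \<le> 4 * sqrt y"
    using shifted_harm_le_sqrt[OF assms(1), of j] assms(2) by (smt (verit) real_sqrt_le_mono)
  moreover have "0 \<le> shifted_harm x j"
    using assms by (intro shifted_harm_nonneg) simp
  ultimately show ?thesis
    by (simp add: abs_mult mult_left_mono)
qed

lemma abs_add_le: "\<bar>x\<bar> \<le> X \<Longrightarrow> \<bar>y\<bar> \<le> Y \<Longrightarrow> \<bar>x + y\<bar> \<le> X + Y" for x y X Y :: real
  by linarith

lemma abs_diff_le: "\<bar>x\<bar> \<le> X \<Longrightarrow> \<bar>y\<bar> \<le> Y \<Longrightarrow> \<bar>x - y\<bar> \<le> X + Y" for x y X Y :: real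
  by linarith

lemma F_logderiv_bound:
  "\<exists>K\<ge>0. \<forall>n k. \<bar>F_logderiv m u w z n k\<bar> \<le> K * sqrt (3 * real n + 2 * real k + 1)"
proof (intro exI conjI allI)
  let ?K = "\<bar>m\<bar> + \<bar>u\<bar> + 4 * (\<bar>w\<bar> + \<bar>z\<bar> + \<bar>u - z\<bar> + \<bar>u - w - z\<bar> + \<bar>u\<bar> + \<bar>u - w\<bar> + \<bar>u - z\<bar> + \<bar>w - u\<bar>)"
  show "0 \<le> ?K" by simp
  fix n k
  define s where "s = sqrt (3 * real n + 2 * real k + 1)"
  have s: "1 \<le> s" unfolding s_def by simp
  have a: "\<bar>m\<bar> \<le> \<bar>m\<bar> * s" using mult_left_mono[OF s, of "\<bar>m\<bar>"] by simp
  have b: "\<bar>u / (1 + 3 * real n + 2 * real k)\<bar> \<le> \<bar>u\<bar> * s"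
  proof -
    have "\<bar>u\<bar> / (1 + 3 * real n + 2 * real k) \<le> \<bar>u\<bar> / 1"
      by (intro divide_left_mono) (auto simp: add_pos_nonneg)
    also have "\<dots> \<le> \<bar>u\<bar> * s" using mult_left_mono[OF s, of "\<bar>u\<bar>"] by simp
    finally show ?thesis by (simp add: abs_divide)
  qed
  have h: "\<bar>c * shifted_harm x j\<bar> \<le> \<bar>c\<bar> * (4 * s)" if "1 / 2 \<le> x" "j \<le> 3 * n + 2 * k + 1" for c x j
    unfolding s_def using that of_nat_mono[OF that(2), where 'a = real] by (intro abs_scaled_shifted_harm_le) auto
  have "\<bar>F_logderiv m u w z n k\<bar> \<le> \<bar>m\<bar> * s + \<bar>u\<bar> * s + \<bar>w\<bar> * (4 * s) + \<bar>z\<bar> * (4 * s) + \<bar>u - z\<bar> * (4 * s)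
      + \<bar>u - w - z\<bar> * (4 * s) + \<bar>u\<bar> * (4 * s) + \<bar>u - w\<bar> * (4 * s) + \<bar>u - z\<bar> * (4 * s) + \<bar>w - u\<bar> * (4 * s)"
    unfolding F_logderiv_def by (intro abs_add_le abs_diff_le a b h) simp_all
  also have "\<dots> = ?K * s" by (simp add: algebra_simps)
  finally show "\<bar>F_logderiv m u w z n k\<bar> \<le> ?K * sqrt (3 * real n + 2 * real k + 1)"
    by (simp add: s_def)
qed

lemma abs_divide_le_self:
  fixes c y :: real
  assumes "1 \<le> y"
  shows "\<bar>c / y\<bar> \<le> \<bar>c\<bar>"
  using assms mult_left_mono[of 1 y "\<bar>c\<bar>"] by (simp add: abs_divide field_simps)

lemma base_R_conv:
  "base_R n k = 1 - (1 / 2 + 2 * real n + real k) * (1 + 2 * real n + real k) /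
        ((1 + 3 * real n + 2 * real k) * (3 / 2 + 3 * real n + real k)) *
        (1 + (1 + real n) / (5 / 2 + 3 * real n + real k))"
proof -
  define A B C D where "A = 1 + 3 * real n + 2 * real k" and "B = 1 / 2 + 2 * real n + real k"
    and "C = 1 + 2 * real n + real k" and "D = 1 / 2 + real k"
  have eqs: "1 + A - B - D = 1 + real n" "1 + A - C - D = 1 / 2 + real n"
    "1 + A - D = 3 / 2 + 3 * real n + real k" "2 + A - D = 5 / 2 + 3 * real n + real k"
    "B + C - A = 1 / 2 + real n"
    by (simp_all add: A_def B_def C_def D_def)
  have nz: "1 / 2 + real n \<noteq> 0" by (simp add: add_pos_nonneg less_imp_neq[symmetric])
  have "base_R n k = wzR A B C D"
    by (simp add: base_R_def A_def B_def C_def D_def)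
  also have "\<dots> = 1 - B * C / (A * (3 / 2 + 3 * real n + real k)) * (1 + (1 + real n) / (5 / 2 + 3 * real n + real k))"
    unfolding wzR_def eqs using nz by simp
  finally show ?thesis unfolding A_def B_def C_def .
qed

text \<open>The certificate and its derivative are bounded in \<open>k\<close>, and the terms are at most
\<open>1 / (2k+1)\<close>, which beats the square-root bound for the logarithmic derivative. At \<open>n = 0\<close>
there is no better bound for the terms, so a bound linear in \<open>k\<close> would not be enough here.\<close>

lemma deriv_G_tendsto_0: "deriv_G m u w z n \<longlonglongrightarrow> 0"
proof -
  obtain K where K: "0 \<le> K" "\<And>n k. \<bar>F_logderiv m u w z n k\<bar> \<le> K * sqrt (3 * real n + 2 * real k + 1)"
    using F_logderiv_bound[of m u w z] by auto
  define M where "M = (\<bar>w\<bar> + \<bar>u\<bar> + \<bar>u - z\<bar>) * 2 + (\<bar>u - z\<bar> + 2 * \<bar>u - w - z\<bar> + 2 * \<bar>w - u\<bar> + \<bar>u - z\<bar>)"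
  have bound: "\<bar>deriv_G m u w z n k\<bar> \<le> 1 / (2 * real k + 1) * (K * sqrt (3 * real n + 2 * real k + 1) * 3 + M)" for k
  proof -
    define P W l1 l2 where "P = (1 / 2 + 2 * real n + real k) * (1 + 2 * real n + real k) /
        ((1 + 3 * real n + 2 * real k) * (3 / 2 + 3 * real n + real k))"
      and "W = (1 + real n) / (5 / 2 + 3 * real n + real k)"
      and "l1 = w / (1 + 2 * real n + real k) - u / (1 + 3 * real n + 2 * real k)
         - (u - z) / (3 / 2 + 3 * real n + real k)"
      and "l2 = (u - z) / (1 + real n) + (u - w - z) / (1 / 2 + real n) - (w - u) / (1 / 2 + real n)
         - (u - z) / (5 / 2 + 3 * real n + real k)"
    have P: "0 \<le> P" "P \<le> 1"
    proof -
      have "(1 / 2 + 2 * real n + real k) * (1 + 2 * real n + real k) \<le>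
          (1 + 3 * real n + 2 * real k) * (3 / 2 + 3 * real n + real k)"
        by (intro mult_mono) auto
      then show "P \<le> 1" by (simp add: P_def)
    qed (simp add: P_def)
    have W: "0 \<le> W" "W \<le> 1" by (simp_all add: W_def)
    have half: "\<bar>c / (1 / 2 + real n)\<bar> \<le> 2 * \<bar>c\<bar>" for c
      using abs_divide_le_self[of "1 + 2 * real n" "2 * c"]
      by (simp add: field_simps abs_mult)
    have l1: "\<bar>l1\<bar> \<le> \<bar>w\<bar> + \<bar>u\<bar> + \<bar>u - z\<bar>"
      unfolding l1_def
      by (intro abs_diff_le abs_divide_le_self) auto
    have l2: "\<bar>l2\<bar> \<le> \<bar>u - z\<bar> + 2 * \<bar>u - w - z\<bar> + 2 * \<bar>w - u\<bar> + \<bar>u - z\<bar>"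
      unfolding l2_def
      by (intro abs_diff_le abs_add_le half abs_divide_le_self) auto
    have R: "\<bar>base_R n k\<bar> \<le> 3"
    proof -
      define y where "y = P * (1 + W)"
      have "base_R n k = 1 - y"
        by (simp add: base_R_conv P_def W_def y_def)
      moreover have "0 \<le> y"
        unfolding y_def using P W by (intro mult_nonneg_nonneg) auto
      moreover have "y \<le> 1 * (1 + 1)"
        unfolding y_def using P W by (intro mult_mono) auto
      ultimately show ?thesis by (simp add: abs_le_iff)
    qed
    have "\<bar>l1 * (1 + W) + W * l2\<bar> \<le> \<bar>l1\<bar> * (1 + W) + W * \<bar>l2\<bar>"
      using abs_triangle_ineq[of "l1 * (1 + W)" "W * l2"] W by (simp add: abs_mult)
    also have "\<dots> \<le> (\<bar>w\<bar> + \<bar>u\<bar> + \<bar>u - z\<bar>) * 2 + 1 * (\<bar>u - z\<bar> + 2 * \<bar>u - w - z\<bar> + 2 * \<bar>w - u\<bar> + \<bar>u - z\<bar>)"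
      using W l1 l2 by (intro add_mono mult_mono) auto
    finally have "P * \<bar>l1 * (1 + W) + W * l2\<bar> \<le> 1 * M"
      using P by (intro mult_mono) (auto simp: M_def)
    moreover have "R_deriv u w z n k = - P * (l1 * (1 + W) + W * l2)"
      by (simp add: R_deriv_def P_def W_def l1_def l2_def)
    ultimately have R': "\<bar>R_deriv u w z n k\<bar> \<le> M"
      using P by (simp add: abs_mult)
    have "\<bar>F_logderiv m u w z n k * base_R n k + R_deriv u w z n k\<bar> \<le> \<bar>F_logderiv m u w z n k\<bar> * \<bar>base_R n k\<bar> + M"
      using R' abs_triangle_ineq[of "F_logderiv m u w z n k * base_R n k" "R_deriv u w z n k"]
      by (simp add: abs_mult)
    also have "\<dots> \<le> K * sqrt (3 * real n + 2 * real k + 1) * 3 + M"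
      using K R by (intro add_right_mono mult_mono) auto
    finally show ?thesis
      unfolding deriv_G_def abs_mult using abs_base_F_le[of n k] K(1)
      by (intro mult_mono) auto
  qed
  have "(\<lambda>k. 1 / (2 * real k + 1) * (K * sqrt (3 * real n + 2 * real k + 1) * 3 + M)) \<longlonglongrightarrow> 0"
  proof -
    have a: "(\<lambda>k. sqrt (3 * real n + 2 * real k + 1) / (2 * real k + 1)) \<longlonglongrightarrow> 0" by real_asymp
    have b: "(\<lambda>k. 1 / (2 * real k + 1)) \<longlonglongrightarrow> 0" by real_asymp
    have "(\<lambda>k. K * 3 * (sqrt (3 * real n + 2 * real k + 1) / (2 * real k + 1)) + M * (1 / (2 * real k + 1))) \<longlonglongrightarrow> K * 3 * 0 + M * 0"
      by (intro tendsto_intros a b)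
    then show ?thesis by (simp add: algebra_simps)
  qed
  then show ?thesis
    by (rule Lim_null_comparison[rotated]) (use bound in auto)
qed

lemma deriv_F_bound:
  "\<exists>K\<ge>0. \<forall>n k. 2 \<le> n \<longrightarrow>
     \<bar>deriv_F m u w z n k\<bar> \<le> K * (3 * real n + 1) * (3 / 4) ^ n * (1 / (real k + 1)\<^sup>2)"
proof -
  obtain K where K: "0 \<le> K" "\<And>n k. \<bar>F_logderiv m u w z n k\<bar> \<le> K * sqrt (3 * real n + 2 * real k + 1)"
    using F_logderiv_bound[of m u w z] by auto
  have "\<bar>deriv_F m u w z n k\<bar> \<le> (128 / 9 * K) * (3 * real n + 1) * (3 / 4) ^ n * (1 / (real k + 1)\<^sup>2)"
    if n: "2 \<le> n" for n k
  proof -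
    have "sqrt (3 * real n + 2 * real k + 1) \<le> 3 * real n + 2 * real k + 1"
      by (rule real_le_lsqrt) (auto intro: self_le_power)
    also have "\<dots> \<le> (3 * real n + 1) * (2 * real k + 1)"
      by (simp add: algebra_simps)
    finally have "K * sqrt (3 * real n + 2 * real k + 1) \<le> K * ((3 * real n + 1) * (2 * real k + 1))"
      using K(1) by (rule mult_left_mono)
    with K(2)[of n k] have "\<bar>F_logderiv m u w z n k\<bar> \<le> K * ((3 * real n + 1) * (2 * real k + 1))"
      by linarith
    then have "\<bar>deriv_F m u w z n k\<bar> \<le> 128 / 9 * (3 / 4) ^ n / ((2 * real k + 1) * (real k + 1)\<^sup>2)
        * (K * ((3 * real n + 1) * (2 * real k + 1)))"
      unfolding deriv_F_def abs_mult using abs_base_F_le_geometric[OF n, of k] by (intro mult_mono) auto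
    also have "\<dots> = (128 / 9 * K) * (3 * real n + 1) * (3 / 4) ^ n * (1 / (real k + 1)\<^sup>2)"
      by (simp add: divide_simps)
    finally show ?thesis .
  qed
  with K(1) show ?thesis by (intro exI[of _ "128 / 9 * K"]) auto
qed

section \<open>The differentiated summation formula\<close>

text \<open>At \<open>n = 0\<close> the logarithmic derivative involves \<open>shifted_harm (3/2) k\<close>, which is
\<open>shifted_harm (1/2) k - 2 + 2 / (2k+1)\<close>. The constant \<open>-2\<close> occurs with the coefficient
\<open>z - 2 u\<close>, and \<open>m\<close> is chosen to cancel it: no multiple of the Leibniz series for
\<open>pi / 4\<close> remains.\<close>

lemma deriv_G_sums:
  assumes m: "m = 2 * (z - 2 * u)"
  shows "(\<lambda>n. deriv_G m u w z n 0) sums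
    ((2 * w - u) * (catalan_const - pi / 2 * ln 2) + (2 * z - 2 * u) * (pi / 4 * ln 2 - catalan_const)
      + (2 * z - 3 * u) * catalan_const)"
proof -
  obtain K where "0 \<le> K \<and> (\<forall>n k. 2 \<le> n \<longrightarrow>
      \<bar>deriv_F m u w z n k\<bar> \<le> K * (3 * real n + 1) * (3 / 4) ^ n * (1 / (real k + 1)\<^sup>2))"
    using deriv_F_bound[of m u w z] ..
  note K = conjunct1[OF this] conjunct2[OF this, rule_format]
  have row: "deriv_F m u w z 0 k =
      (2 * w - u) * ((-1) ^ k / (2 * real k + 1) * shifted_harm 1 k) +
      (2 * z - 2 * u) * ((-1) ^ k / (2 * real k + 1) * shifted_harm (1 / 2) k) +
      (2 * z - 3 * u) * ((-1) ^ k / (2 * real k + 1) ^ 2)" for k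
  proof -
    have "F_logderiv m u w z 0 k = (2 * w - u) * shifted_harm 1 k + (2 * z - 2 * u) * shifted_harm (1 / 2) k
        + (2 * z - 3 * u) / (2 * real k + 1)"
    proof -
      define d where "d = 1 / (2 * real k + 1)"
      have "u / (1 + 3 * real 0 + 2 * real k) = u * d" "2 / (2 * real k + 1) = 2 * d"
        "(2 * z - 3 * u) / (2 * real k + 1) = (2 * z - 3 * u) * d"
        by (simp_all add: d_def add.commute)
      then show ?thesis
        unfolding F_logderiv_def m shifted_harm_three_halves by (simp add: algebra_simps)
    qed
    then show ?thesis
      unfolding deriv_F_def base_F_0 by (simp add: power2_eq_square distrib_left mult_ac)
  qed
  have "(\<lambda>k. (-1) ^ k / (2 * real k + 1) ^ 2) sums catalan_const"
    unfolding catalan_const_def by (rule summable_sums[OF summable_catalan])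
  then have F0: "deriv_F m u w z 0 sums ((2 * w - u) * (catalan_const - pi / 2 * ln 2)
      + (2 * z - 2 * u) * (pi / 4 * ln 2 - catalan_const) + (2 * z - 3 * u) * catalan_const)"
    unfolding row[abs_def]
    by (intro sums_add sums_mult alternating_harm_sums alternating_odd_harm_sums)
  show ?thesis
  proof (rule sums_via_wz_pair[where F = "deriv_F m u w z"
        and B = "\<lambda>n. K * (3 * real n + 1) * (3 / 4) ^ n" and c = "\<lambda>k. 1 / (real k + 1)\<^sup>2",
        OF deriv_wz_pair F0 deriv_G_tendsto_0 K(2)])
    have "(\<lambda>n. (3 * real n + 1) * (3 / 4) ^ n) \<longlonglongrightarrow> 0" by real_asymp
    from tendsto_mult_right[OF this, of K]
    show "(\<lambda>n. K * (3 * real n + 1) * (3 / 4) ^ n) \<longlonglongrightarrow> 0"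
      by (simp add: mult_ac)
    show "summable (\<lambda>k. 1 / (real k + 1)\<^sup>2)"
      using inverse_power_summable[of 2, where 'a = real] summable_Suc_iff[of "\<lambda>n. inverse (real n ^ 2)"]
      by (simp add: inverse_eq_divide add.commute)
  qed (use K(1) in auto)
qed

section \<open>The three series\<close>

definition weight :: "nat \<Rightarrow> real" where
  "weight n = 4 ^ n * fact n * pochhammer (1 / 2) (2 * n) / pochhammer (1 / 2) (3 * n + 3)"

text \<open>By the duplication formula for factorials the central binomial coefficients become
\<open>16^k (1/2)_{2k} / (2k)!\<close> and \<open>64^k (1/2)_{3k} / (3k)!\<close>, and the last two factors of
\<open>(1/2)_{2k}\<close> cancel \<open>(4k-1)(4k-3)\<close>. The factor \<open>y\<close> lets the equation rewrite all
three summands of the theorem.\<close>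

lemma weight_conv_binomial:
  defines "k \<equiv> \<lambda>n. Suc n" and "x \<equiv> \<lambda>n. real (Suc n)"
  shows "16 ^ k n * real ((4 * k n) choose (2 * k n)) * y /
      (x n * (4 * x n - 1) * (4 * x n - 3) * real ((3 * k n) choose k n) * real ((6 * k n) choose (3 * k n)))
    = weight n * y"
proof -
  define f p :: "nat \<Rightarrow> real" where "f = fact" and "p = pochhammer (1 / 2)"
  have pos: "f j > 0" "p j > 0" for j
    by (simp_all add: f_def p_def pochhammer_pos)
  have c1: "real ((4 * k n) choose (2 * k n)) = 16 ^ k n * p (2 * k n) / f (2 * k n)"
    using binomial_fact[of "2 * k n" "4 * k n", where 'a = real] fact_double[of "2 * k n", where 'a = real]
    by (simp add: f_def p_def power_mult)
  have c2: "real ((3 * k n) choose k n) = f (3 * k n) / (f (k n) * f (2 * k n))"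
    using binomial_fact[of "k n" "3 * k n", where 'a = real] by (simp add: f_def)
  have c3: "real ((6 * k n) choose (3 * k n)) = 64 ^ k n * p (3 * k n) / f (3 * k n)"
    using binomial_fact[of "3 * k n" "6 * k n", where 'a = real] fact_double[of "3 * k n", where 'a = real]
    by (simp add: f_def p_def power_mult)
  have p2: "p (2 * k n) = p (2 * n) * ((4 * x n - 3) * (4 * x n - 1)) / 4"
  proof -
    have "2 * k n = Suc (Suc (2 * n))" by (simp add: k_def)
    then show ?thesis by (simp add: p_def pochhammer_Suc x_def field_simps)
  qed
  have f1: "f (k n) = x n * f n" by (simp add: f_def k_def x_def)
  have "3 * k n = 3 * n + 3" by (simp add: k_def)
  then have w: "weight n = 4 ^ n * f n * p (2 * n) / p (3 * k n)"
    by (simp add: weight_def f_def p_def)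
  \<comment> \<open>The powers of 16 and 64 leave 4 ^ k.\<close>
  have "(16::real) ^ k n * 16 ^ k n = 4 * 4 ^ n * 64 ^ k n"
    by (simp add: k_def flip: power_mult_distrib)
  moreover have "x n > 0" "4 * x n - 1 > 0" "4 * x n - 3 > 0" by (simp_all add: x_def)
  ultimately show ?thesis
    unfolding w c1 c2 c3 p2 f1 using pos[of "2 * k n"] pos[of "3 * k n"] pos[of n] pos[of "2 * n"]
    by (simp add: divide_simps)
qed

lemma base_F_n_0: "base_F n 0 = 3 / 8 * weight n * ((3 * real n + 1) * (6 * real n + 5))"
proof -
  define p :: "nat \<Rightarrow> real" where "p = pochhammer (1 / 2)"
  have pos: "p j > 0" for j by (simp add: p_def pochhammer_pos)
  have d: "(fact (2 * n) :: real) = 4 ^ n * p n * fact n"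
    using fact_double[of n, where 'a = real] by (simp add: p_def power_mult)
  have p0: "p 0 = 1" by (simp add: p_def)
  have h: "pochhammer (3 / 2 :: real) j = (2 * real j + 1) * p j" for j
    by (simp add: p_def pochhammer_three_halves)
  have "3 * n + 3 = Suc (Suc (Suc (3 * n)))" by simp
  then have p3: "p (3 * n + 3) = p (3 * n) * ((6 * real n + 1) / 2) * (3 * (2 * real n + 1) / 2) * ((6 * real n + 5) / 2)"
    by (simp only: p_def pochhammer_Suc) (simp add: field_simps)
  have "base_F n 0 = (1 + 3 * real n) * (p (2 * n) * (4 ^ n * p n * fact n) * fact n * p n) /
      ((2 * real n + 1) * p n * fact n * ((2 * (3 * real n) + 1) * p (3 * n)) * p n)"
    by (simp add: wzF_def h d p0 pochhammer_fact[symmetric] flip: p_def)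
  also have "\<dots> = (1 + 3 * real n) * (p (2 * n) * 4 ^ n * fact n) / ((2 * real n + 1) * ((6 * real n + 1) * p (3 * n)))"
    using pos[of n] by (simp add: divide_simps)
  also have "\<dots> = 3 / 8 * weight n * ((3 * real n + 1) * (6 * real n + 5))"
  proof -
    have "6 * real n + 1 \<noteq> 0" "2 * real n + 1 \<noteq> 0" "6 * real n + 5 \<noteq> 0" "p (3 * n) \<noteq> 0"
      using pos[of "3 * n"] by (simp_all add: add_nonneg_pos less_imp_neq[symmetric])
    moreover have "e * (s * q * r) / (a * (b * t)) =
        3 / 8 * (q * r * s / (t * (b / 2) * (3 * a / 2) * (c / 2))) * (e * c)"
      if "b \<noteq> 0" "a \<noteq> 0" "c \<noteq> 0" "t \<noteq> 0" for a b c e q r s t :: real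
      using that by (simp add: field_simps)
    ultimately show ?thesis
      unfolding weight_def p_def[symmetric] p3 by (simp only: add.commute[of 1])
  qed
  finally show ?thesis .
qed

text \<open>This is the origin of the polynomial \<open>Q\<close>: by \<open>base_F_n_0\<close> the left-hand side is, up to the
weight, eight times \<open>G(n,0)\<close> at the base point.\<close>

lemma base_R_n_0:
  "3 * ((3 * real n + 1) * (6 * real n + 5)) * base_R n 0 = Q (real (Suc n))"
proof -
  define y where "y = real n"
  have y: "y \<ge> 0" by (simp add: y_def)
  have "1 + 3 * y > 0" "3 / 2 + 3 * y > 0" "5 / 2 + 3 * y > 0" using y by auto
  then show ?thesis
    unfolding base_R_conv Q_def of_nat_Suc y_def[symmetric] by (simp add: divide_simps) (simp add: algebra_simps)
qed

lemma deriv_G_n_0: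
  "8 * deriv_G m u w z n 0 = weight n * (Q (real (Suc n)) * F_logderiv m u w z n 0
      + 3 * ((3 * real n + 1) * (6 * real n + 5)) * R_deriv u w z n 0)"
proof -
  have "8 * (3 / 8 * t * c * (l * r + d)) = t * (3 * c * r * l + 3 * c * d)" for t c l r d :: real
    by (simp add: algebra_simps)
  then show ?thesis
    unfolding deriv_G_def base_F_n_0 base_R_n_0[symmetric] .
qed

lemma R_deriv_n_0:
  fixes n :: nat
  defines "y \<equiv> real n"
  shows "3 * ((3 * y + 1) * (6 * y + 5)) * R_deriv u w z n 0 =
    - (4 * y + 1) * ((w / (2 * y + 1) - u / (3 * y + 1) - 2 * (u - z) / (3 * (2 * y + 1))) * (8 * y + 7)
       + 2 * (y + 1) * ((u - z) / (y + 1) + 2 * (2 * u - 2 * w - z) / (2 * y + 1) - 2 * (u - z) / (6 * y + 5)))"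
proof -
  have y: "y \<ge> 0" by (simp add: y_def)
  define l1 l2 where "l1 = w / (2 * y + 1) - u / (3 * y + 1) - 2 * (u - z) / (3 * (2 * y + 1))"
    and "l2 = (u - z) / (y + 1) + 2 * (2 * u - 2 * w - z) / (2 * y + 1) - 2 * (u - z) / (6 * y + 5)"
  have e: "1 / 2 + 2 * y = (4 * y + 1) / 2" "3 / 2 + 3 * y = 3 * (2 * y + 1) / 2" "5 / 2 + 3 * y = (6 * y + 5) / 2"
    "1 / 2 + y = (2 * y + 1) / 2" "1 + 2 * y = 2 * y + 1" "1 + 3 * y = 3 * y + 1" "1 + y = y + 1"
    by simp_all
  have "R_deriv u w z n 0 = - ((4 * y + 1) / (3 * (3 * y + 1))) *
      (l1 * ((8 * y + 7) / (6 * y + 5)) + 2 * (y + 1) / (6 * y + 5) * l2)"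
  proof -
    have a: "(1 / 2 + 2 * y) * (1 + 2 * y) / ((1 + 3 * y) * (3 / 2 + 3 * y)) = (4 * y + 1) / (3 * (3 * y + 1))"
      using y by (simp add: divide_simps) (simp add: algebra_simps)
    have b: "1 + (1 + y) / (5 / 2 + 3 * y) = (8 * y + 7) / (6 * y + 5)"
      using y by (simp add: divide_simps) (simp add: algebra_simps)
    have c: "(1 + y) / (5 / 2 + 3 * y) = 2 * (y + 1) / (6 * y + 5)"
      using y by (simp add: divide_simps) (simp add: algebra_simps)
    have d: "w / (1 + 2 * y) - u / (1 + 3 * y) - (u - z) / (3 / 2 + 3 * y) = l1"
      unfolding l1_def e by (simp add: mult.commute)
    have f: "(u - z) / (1 + y) + (u - w - z) / (1 / 2 + y) - (w - u) / (1 / 2 + y) - (u - z) / (5 / 2 + 3 * y) = l2"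
    proof -
      have "c / (1 / 2 + y) = 2 * c / (2 * y + 1)" "c / (5 / 2 + 3 * y) = 2 * c / (6 * y + 5)" for c
        unfolding e by simp_all
      moreover have "2 * (u - w - z) / (2 * y + 1) - 2 * (w - u) / (2 * y + 1) = 2 * (2 * u - 2 * w - z) / (2 * y + 1)"
        by (simp add: algebra_simps flip: diff_divide_distrib)
      ultimately show ?thesis
        unfolding l2_def by (simp add: add.commute)
    qed
    show ?thesis
      unfolding R_deriv_def y_def[symmetric] using a b c d f by simp
  qed
  moreover have "3 * (a * c) * (- (e / (3 * a)) * (s * (f / c) + g / c * t)) = - e * (s * f + g * t)"
    if "a \<noteq> 0" "c \<noteq> 0" for a c e f g s t :: real
    using that by (simp add: field_simps)
  moreover have "3 * y + 1 \<noteq> 0" "6 * y + 5 \<noteq> 0" using y by simp_all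
  ultimately have "3 * ((3 * y + 1) * (6 * y + 5)) * R_deriv u w z n 0 =
      - (4 * y + 1) * (l1 * (8 * y + 7) + 2 * (y + 1) * l2)"
    by (simp only: not_False_eq_True)
  then show ?thesis unfolding l1_def l2_def .
qed

text \<open>In the direction \<open>(-1, 0, -1)\<close> the sums over \<open>2n\<close> and \<open>3n\<close> terms drop out because
\<open>w = 0\<close> and \<open>u = z\<close>, and those with half-integer denominators cancel up to a rational
function.\<close>

lemma summand_harm:
  fixes n :: nat
  defines "x \<equiv> real (Suc n)"
  shows "8 * deriv_G 2 (-1) 0 (-1) n 0 =
    weight n * (Q x * harm n + (6 * x - 1) * (4 * x - 3) / (2 * x - 1))"
proof -
  define y where "y = real n"
  have y: "y \<ge> 0" by (simp add: y_def)
  have x: "x = y + 1" by (simp add: x_def y_def)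
  have L: "F_logderiv 2 (-1) 0 (-1) n 0 = harm n + (2 / (2 * y + 1) - 1 / (3 * y + 1))"
    by (simp add: F_logderiv_def harm_conv_shifted_harm shifted_harm_three_halves y_def add.commute)
  have "Q x * (2 / (2 * y + 1) - 1 / (3 * y + 1)) +
      3 * ((3 * y + 1) * (6 * y + 5)) * R_deriv (-1) 0 (-1) n 0 = (6 * x - 1) * (4 * x - 3) / (2 * x - 1)"
    unfolding y_def R_deriv_n_0 unfolding y_def[symmetric] Q_def x
    using y by (simp add: divide_simps) (simp add: algebra_simps)
  then show ?thesis
    unfolding deriv_G_n_0 L x_def[symmetric] y_def[symmetric] by (simp add: distrib_left add.assoc)
qed

text \<open>In the direction \<open>(-1, -1/3, -1)\<close> the sums with integer and with half-integer denominators occur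
with equal coefficients, and \<open>shifted_harm_double\<close> combines them into a harmonic number with index
\<open>2n\<close>.\<close>

lemma summand_harm_double:
  fixes n :: nat
  defines "x \<equiv> real (Suc n)"
  shows "8 * deriv_G 2 (-1) (-1/3) (-1) n 0 =
    weight n * (Q x * harm (2 * n + 1) + (6 * x - 1) * (x - 3) / (6 * x - 3))"
proof -
  define y where "y = real n"
  have y: "y \<ge> 0" by (simp add: y_def)
  have x: "x = y + 1" by (simp add: x_def y_def)
  have H: "harm (2 * n + 1) = shifted_harm 1 (2 * n) + 1 / (2 * y + 1)"
    by (simp add: harm_conv_shifted_harm shifted_harm_Suc y_def add.commute)
  have L: "F_logderiv 2 (-1) (-1/3) (-1) n 0 = harm (2 * n + 1) + (1 / (2 * y + 1) - 1 / (3 * y + 1))"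
  proof -
    define d1 d2 where "d1 = 1 / (2 * y + 1)" and "d2 = 1 / (3 * y + 1)"
    have e: "2 / (2 * real n + 1) = 2 * d1" "-1 / (1 + 3 * real n + 2 * real 0) = - d2"
      "1 / (2 * y + 1) = d1" "1 / (3 * y + 1) = d2"
      by (simp_all add: d1_def d2_def y_def add.commute)
    show ?thesis
      unfolding F_logderiv_def H add_0_right shifted_harm_double shifted_harm_three_halves e
      by (simp add: field_simps)
  qed
  have "Q x * (1 / (2 * y + 1) - 1 / (3 * y + 1)) +
      3 * ((3 * y + 1) * (6 * y + 5)) * R_deriv (-1) (-1/3) (-1) n 0 = (6 * x - 1) * (x - 3) / (6 * x - 3)"
    unfolding y_def R_deriv_n_0 unfolding y_def[symmetric] Q_def x
    using y by (simp add: divide_simps) (simp add: algebra_simps)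
  then show ?thesis
    unfolding deriv_G_n_0 L x_def[symmetric] y_def[symmetric] by (simp add: distrib_left add.assoc)
qed

text \<open>In the direction \<open>(-2, -2/3, -1)\<close> the sums over \<open>n\<close> and \<open>2n\<close> terms cancel by
\<open>shifted_harm_double\<close>, up to a rational function, and the one over \<open>3n\<close> terms remains with
coefficient \<open>z - u = 1\<close>.\<close>

lemma summand_odd_harm:
  fixes n :: nat
  defines "x \<equiv> real (Suc n)"
  shows "8 * deriv_G 6 (-2) (-2/3) (-1) n 0 =
    weight n * (Q x * shifted_harm (1 / 2) (3 * n + 3) + 4 * (18 * x ^ 2 - 20 * x + 3) / (6 * x - 3))"
proof -
  define y where "y = real n"
  have y: "y \<ge> 0" by (simp add: y_def)
  have x: "x = y + 1" by (simp add: x_def y_def)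
  have "3 * n + 3 = Suc (Suc (Suc (3 * n)))" by simp
  then have "shifted_harm (1 / 2) (3 * n + 3) = shifted_harm (1 / 2) (3 * n)
      + 1 / (1 / 2 + real (3 * n)) + 1 / (1 / 2 + real (Suc (3 * n))) + 1 / (1 / 2 + real (Suc (Suc (3 * n))))"
    by (simp only: shifted_harm_Suc)
  also have "1 / (1 / 2 + real (3 * n)) = 2 / (6 * y + 1)"
    by (simp add: y_def field_simps)
  also have "1 / (1 / 2 + real (Suc (3 * n))) = 2 / (3 * (2 * y + 1))"
    by (simp add: y_def field_simps)
  also have "1 / (1 / 2 + real (Suc (Suc (3 * n)))) = 2 / (6 * y + 5)"
    by (simp add: y_def field_simps)
  finally have H: "shifted_harm (1 / 2) (3 * n + 3) = shifted_harm (1 / 2) (3 * n)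
      + 2 / (6 * y + 1) + 2 / (3 * (2 * y + 1)) + 2 / (6 * y + 5)" .
  have L: "F_logderiv 6 (-2) (-2/3) (-1) n 0 = shifted_harm (1 / 2) (3 * n + 3)
      + (4 / (2 * y + 1) - 2 / (3 * y + 1) - 2 / (3 * (2 * y + 1)) - 2 / (6 * y + 5))"
  proof -
    \<comment> \<open>Opaque names for the reciprocals keep the identity linear in them.\<close>
    define d1 d2 d3 d4 where "d1 = 1 / (2 * y + 1)" and "d2 = 1 / (3 * y + 1)" and "d3 = 1 / (6 * y + 1)"
      and "d4 = 1 / (6 * y + 5)"
    have e: "2 / (2 * real n + 1) = 2 * d1" "2 / (2 * real (3 * n) + 1) = 2 * d3"
      "-2 / (1 + 3 * real n + 2 * real 0) = -2 * d2" "4 / (2 * y + 1) = 4 * d1" "2 / (3 * y + 1) = 2 * d2"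
      "2 / (3 * (2 * y + 1)) = 2 * d1 / 3" "2 / (6 * y + 1) = 2 * d3" "2 / (6 * y + 5) = 2 * d4"
      by (simp_all add: d1_def d2_def d3_def d4_def y_def add.commute)
    show ?thesis
      unfolding F_logderiv_def H add_0_right shifted_harm_double shifted_harm_three_halves e
      by (simp add: field_simps)
  qed
  have "Q x * (4 / (2 * y + 1) - 2 / (3 * y + 1) - 2 / (3 * (2 * y + 1)) - 2 / (6 * y + 5)) +
      3 * ((3 * y + 1) * (6 * y + 5)) * R_deriv (-2) (-2/3) (-1) n 0 = 4 * (18 * x ^ 2 - 20 * x + 3) / (6 * x - 3)"
    unfolding y_def R_deriv_n_0 unfolding y_def[symmetric] Q_def x
    using y by (simp add: divide_simps) (simp add: algebra_simps power2_eq_square)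
  then show ?thesis
    unfolding deriv_G_n_0 L x_def[symmetric] y_def[symmetric] by (simp add: distrib_left add.assoc)
qed

theorem theorem1p14:
  shows
    "((\<lambda>n. let k = Suc n; x = real k in
        16 ^ k * real ((4 * k) choose (2 * k)) *
          (Q x * harm (k - 1) + (6 * x - 1) * (4 * x - 3) / (2 * x - 1)) /
        (x * (4 * x - 1) * (4 * x - 3) * real ((3 * k) choose k) * real ((6 * k) choose (3 * k))))
       sums (16 * catalan_const - 4 * pi * ln 2)) \<and>
     ((\<lambda>n. let k = Suc n; x = real k in
        16 ^ k * real ((4 * k) choose (2 * k)) *
          (Q x * harm (2 * k - 1) + (6 * x - 1) * (x - 3) / (6 * x - 3)) /
        (x * (4 * x - 1) * (4 * x - 3) * real ((3 * k) choose k) * real ((6 * k) choose (3 * k))))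
       sums (4 / 3 * (8 * catalan_const - pi * ln 2))) \<and>
     ((\<lambda>n. let k = Suc n; x = real k in
        16 ^ k * real ((4 * k) choose (2 * k)) *
          (Q x * (2 * harm (6 * k - 1) - harm (3 * k - 1)) +
            4 * (18 * x ^ 2 - 20 * x + 3) / (6 * x - 3)) /
        (x * (4 * x - 1) * (4 * x - 3) * real ((3 * k) choose k) * real ((6 * k) choose (3 * k))))
       sums (4 / 3 * (16 * catalan_const + pi * ln 2)))"
proof (intro conjI)
  have h: "harm (Suc n - 1) = (harm n :: real)" "harm (2 * Suc n - 1) = (harm (2 * n + 1) :: real)"
    "2 * harm (6 * Suc n - 1) - harm (3 * Suc n - 1) = shifted_harm (1 / 2) (3 * n + 3)" for n
    using two_harm_minus_harm[of "3 * n + 3"] by (simp_all add: add.commute)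
  show "(\<lambda>n. let k = Suc n; x = real k in
        16 ^ k * real ((4 * k) choose (2 * k)) *
          (Q x * harm (k - 1) + (6 * x - 1) * (4 * x - 3) / (2 * x - 1)) /
        (x * (4 * x - 1) * (4 * x - 3) * real ((3 * k) choose k) * real ((6 * k) choose (3 * k))))
       sums (16 * catalan_const - 4 * pi * ln 2)"
    unfolding Let_def weight_conv_binomial h summand_harm[symmetric]
    using sums_mult[OF deriv_G_sums[of 2 "-1" "-1" 0], of 8] by (simp add: algebra_simps)
  show "(\<lambda>n. let k = Suc n; x = real k in
        16 ^ k * real ((4 * k) choose (2 * k)) *
          (Q x * harm (2 * k - 1) + (6 * x - 1) * (x - 3) / (6 * x - 3)) /
        (x * (4 * x - 1) * (4 * x - 3) * real ((3 * k) choose k) * real ((6 * k) choose (3 * k))))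
       sums (4 / 3 * (8 * catalan_const - pi * ln 2))"
    unfolding Let_def weight_conv_binomial h summand_harm_double[symmetric]
    using sums_mult[OF deriv_G_sums[of 2 "-1" "-1" "-1/3"], of 8] by (simp add: algebra_simps)
  show "(\<lambda>n. let k = Suc n; x = real k in
        16 ^ k * real ((4 * k) choose (2 * k)) *
          (Q x * (2 * harm (6 * k - 1) - harm (3 * k - 1)) +
            4 * (18 * x ^ 2 - 20 * x + 3) / (6 * x - 3)) /
        (x * (4 * x - 1) * (4 * x - 3) * real ((3 * k) choose k) * real ((6 * k) choose (3 * k))))
       sums (4 / 3 * (16 * catalan_const + pi * ln 2))"
    unfolding Let_def weight_conv_binomial h summand_odd_harm[symmetric]
    using sums_mult[OF deriv_G_sums[of 6 "-1" "-2" "-2/3"], of 8] by (simp add: algebra_simps)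
qed

end
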